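(* Let $q$ be a complex number with $|q|<1$ and let $R(q)=\dfrac{(q,q^4;q^5)_\infty}{(q^2,q^3;q^5)_\infty}$. Then \begin{align*} \frac{R(q)^2}{R(q^2)} &=\frac{(-q^5,-q^{10},-q^{10},-q^{10},-q^{15},-q^{15},-q^{15},-q^{20};q^{25})_\infty}{(q^5,q^{10},q^{10},q^{10},q^{15},q^{15},q^{15},q^{20};q^{25})_\infty} -2q\,\frac{(-q^5,-q^{10},-q^{10},-q^{15},-q^{15},-q^{20},-q^{25},-q^{25};q^{25})_\infty}{(q^5,q^5,q^5,q^{10},q^{15},q^{20},q^{20},q^{20};q^{25})_\infty}\\ &\quad+4q^2\,\frac{(-q^5,-q^{10},-q^{10},-q^{15},-q^{15},-q^{20},-q^{25},-q^{25};q^{25})_\infty}{(q^5,q^5,q^{10},q^{10},q^{15},q^{15},q^{20},q^{20};q^{25})_\infty} -4q^3\,\frac{(-q^{10},-q^{10},-q^{15},-q^{15},-q^{25},-q^{25},-q^{25},-q^{25};q^{25})_\infty}{(q^5,q^5,q^5,q^{10},q^{15},q^{20},q^{20},q^{20};q^{25})_\infty}\\ &\quad+2q^4\,\frac{(-q^5,-q^5,-q^{10},-q^{15},-q^{20},-q^{20},-q^{25},-q^{25};q^{25})_\infty}{(q^5,q^{10},q^{10},q^{10},q^{15},q^{15},q^{15},q^{20};q^{25})_\infty} \end{align*} and \begin{align*} \frac{R(q^2)}{R(q)^2} &=\frac{(-q^5,-q^5,-q^5,-q^{10},-q^{15},-q^{20},-q^{20},-q^{20};q^{25})_\infty}{(q^5,q^5,q^5,q^{10},q^{15},q^{20},q^{20},q^{20};q^{25})_\infty}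 +2q\,\frac{(-q^5,-q^{10},-q^{10},-q^{15},-q^{15},-q^{20},-q^{25},-q^{25};q^{25})_\infty}{(q^5,q^5,q^5,q^{10},q^{15},q^{20},q^{20},q^{20};q^{25})_\infty}\\ &\quad-4q^7\,\frac{(-q^5,-q^5,-q^{20},-q^{20},-q^{25},-q^{25},-q^{25},-q^{25};q^{25})_\infty}{(q^5,q^{10},q^{10},q^{10},q^{15},q^{15},q^{15},q^{20};q^{25})_\infty} -4q^3\,\frac{(-q^5,-q^5,-q^{10},-q^{15},-q^{20},-q^{20},-q^{25},-q^{25};q^{25})_\infty}{(q^5,q^5,q^{10},q^{10},q^{15},q^{15},q^{20},q^{20};q^{25})_\infty}\\ &\quad-2q^4\,\frac{(-q^5,-q^5,-q^{10},-q^{15},-q^{20},-q^{20},-q^{25},-q^{25};q^{25})_\infty}{(q^5,q^{10},q^{10},q^{10},q^{15},q^{15},q^{15},q^{20};q^{25})_\infty}. \end{align*}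
   Context: For $|q|<1$: $(A;q)_\infty=\prod_{k\ge0}(1-Aq^k)$ and $(A_1,\dots,A_n;q)_\infty=(A_1;q)_\infty\cdots(A_n;q)_\infty$ (repeated entries are repeated factors). $R(q)$ is the Rogers--Ramanujan continued fraction $\frac{1}{1+}\frac{q}{1+}\frac{q^2}{1+}\cdots$ without the factor $q^{1/5}$, which equals the stated product. *)

theory Defs
  imports "HOL-Analysis.Analysis"
begin

definition qpoch_inf :: "complex \<Rightarrow> complex \<Rightarrow> complex" where
  "qpoch_inf A q = (\<Prod>k. 1 - A * q ^ k)"

(* (A_1, ..., A_n; q)_\<infinity>; a list, since repeated parameters are repeated factors *)
definition qpochs_inf :: "complex list \<Rightarrow> complex \<Rightarrow> complex" where
  "qpochs_inf As q = (\<Prod>A\<leftarrow>As. qpoch_inf A q)"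

(* The Rogers-Ramanujan continued fraction without the factor q^(1/5), in product form. *)
definition RR :: "complex \<Rightarrow> complex" where
  "RR q = qpochs_inf [q, q^4] (q^5) / qpochs_inf [q^2, q^3] (q^5)"

end

theory Submission
  imports Defs "HOL-Complex_Analysis.Complex_Analysis"
begin

text \<open>
  Put \<open>F(q) = R(q)\<^sup>2 / R(q\<^sup>2)\<close>, \<open>u = R(q\<^sup>5)\<close>, \<open>v = R(q\<^sup>1\<^sup>0)\<close>, \<open>x = q u\<close>, \<open>y = q\<^sup>2 v\<close>, \<open>K = x y\<^sup>2\<close>,
  and let \<open>A\<close> and \<open>B\<close> be the two right-hand sides. Three-term relations between theta functions
  of nome \<open>q\<^sup>1\<^sup>0\<close> and \<open>q\<^sup>5\<close> show that \<open>1/F - F = 4 q M(q\<^sup>5)\<^sup>5 / M(q)\<close> with \<open>M(q) = (-q; q)\<^sub>\<infinity>\<close>, that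
  \<open>M(q\<^sup>5)\<^sup>5 / M(q\<^sup>2\<^sup>5) = (1 + K - K\<^sup>2) / (1 - 4 K - K\<^sup>2)\<close>, that \<open>x\<^sup>2 (1 + K) = y (1 - K)\<close>, and that
  \<open>A\<close> and \<open>B\<close>, multiplied by \<open>1 - 4 K - K\<^sup>2\<close>, are polynomials in \<open>x\<close> and \<open>y\<close>. Ramanujan's dissection
  \<open>(q; q)\<^sub>\<infinity> = (q\<^sup>2\<^sup>5; q\<^sup>2\<^sup>5)\<^sub>\<infinity> (1/u - q - q\<^sup>2 u)\<close>, taken at \<open>q\<close> and at \<open>q\<^sup>2\<close>, expresses \<open>M(q) / M(q\<^sup>2\<^sup>5)\<close>
  through \<open>x\<close> and \<open>y\<close>. Polynomial algebra then gives \<open>A B = 1\<close> and \<open>B - A = 1/F - F\<close>, so that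
  \<open>(F - A) (F + B) = 0\<close>. Since \<open>F + B\<close> is \<open>2\<close> at the origin, \<open>F = A\<close> near the origin and
  hence, by analytic continuation, on the whole disc.
\<close>

section \<open>Infinite products\<close>

lemma summable_norm_qpoch_terms:
  fixes A p :: complex
  assumes "norm p < 1"
  shows "summable (\<lambda>k. norm (A * p ^ k))"
  using assms by (simp add: norm_mult norm_power summable_mult)

lemma qpoch_inf_has_prod:
  assumes "norm p < 1"
  shows "(\<lambda>k. 1 - A * p ^ k) has_prod qpoch_inf A p"
proof -
  have "abs_convergent_prod (\<lambda>k. 1 + (- (A * p ^ k)))"
    by (rule summable_imp_abs_convergent_prod)
       (use summable_norm_qpoch_terms[OF assms, of A] in simp)
  then have "convergent_prod (\<lambda>k. 1 - A * p ^ k)"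
    using abs_convergent_prod_imp_convergent_prod by fastforce
  then show ?thesis
    unfolding qpoch_inf_def by (rule convergent_prod_has_prod)
qed

lemma qpoch_inf_LIMSEQ:
  assumes "norm p < 1"
  shows "(\<lambda>n. \<Prod>k<n. 1 - A * p ^ k) \<longlonglongrightarrow> qpoch_inf A p"
  using has_prod_imp_tendsto'[OF qpoch_inf_has_prod[OF assms]] .

lemma qpoch_inf_eq_0_iff:
  assumes "norm p < 1"
  shows "qpoch_inf A p = 0 \<longleftrightarrow> (\<exists>k. A * p ^ k = 1)"
  using has_prod_eq_0_iff[OF qpoch_inf_has_prod[OF assms, of A]] by (auto simp: image_iff)

lemma qpoch_inf_nonzero:
  assumes "norm p < 1" "norm A < 1"
  shows "qpoch_inf A p \<noteq> 0"
proof -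
  have "norm (A * p ^ k) < 1" for k
  proof -
    have "norm A * norm p ^ k \<le> norm A * 1"
      using assms by (intro mult_left_mono power_le_one) auto
    then show ?thesis
      using assms by (simp add: norm_mult norm_power)
  qed
  then have "A * p ^ k \<noteq> 1" for k
    by (metis less_irrefl norm_one)
  then show ?thesis
    using qpoch_inf_eq_0_iff[OF assms(1)] by blast
qed

lemma qpoch_inf_rec:
  assumes "norm p < 1"
  shows "qpoch_inf A p = (1 - A) * qpoch_inf (A * p) p"
proof -
  have "(\<lambda>n. \<Prod>k<Suc n. 1 - A * p ^ k) \<longlonglongrightarrow> qpoch_inf A p"
    using qpoch_inf_LIMSEQ[OF assms] by (rule LIMSEQ_Suc)
  moreover have "(\<Prod>k<Suc n. 1 - A * p ^ k) = (1 - A) * (\<Prod>k<n. 1 - (A * p) * p ^ k)" for n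
    by (subst prod.lessThan_Suc_shift) (simp add: mult.assoc)
  moreover have "(\<lambda>n. (1 - A) * (\<Prod>k<n. 1 - (A * p) * p ^ k)) \<longlonglongrightarrow> (1 - A) * qpoch_inf (A * p) p"
    by (intro tendsto_intros qpoch_inf_LIMSEQ assms)
  ultimately show ?thesis
    using LIMSEQ_unique by fastforce
qed

lemma qpoch_inf_0 [simp]: "qpoch_inf 0 p = 1"
  by (simp add: qpoch_inf_def)

lemma qpoch_inf_mult_minus:
  assumes "norm p < 1"
  shows "qpoch_inf A p * qpoch_inf (- A) p = qpoch_inf (A^2) (p^2)"
proof -
  have "norm (p^2) < 1"
    using assms by (simp add: norm_power power_less_one_iff)
  then have "(\<lambda>n. \<Prod>k<n. 1 - A^2 * (p^2) ^ k) \<longlonglongrightarrow> qpoch_inf (A^2) (p^2)"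
    by (rule qpoch_inf_LIMSEQ)
  moreover have "(\<Prod>k<n. 1 - A^2 * (p^2) ^ k) = (\<Prod>k<n. 1 - A * p ^ k) * (\<Prod>k<n. 1 - (- A) * p ^ k)" for n
    by (simp add: prod.distrib[symmetric] algebra_simps power2_eq_square power_mult_distrib)
  ultimately show ?thesis
    using tendsto_mult[OF qpoch_inf_LIMSEQ[OF assms, of A] qpoch_inf_LIMSEQ[OF assms, of "- A"]]
      LIMSEQ_unique by fastforce
qed

text \<open>The factors are grouped by the residue of the index \<open>k\<close> modulo
  \<open>n\<close>.\<close>

lemma qpoch_inf_multisection:
  assumes "norm p < 1" "n > 0"
  shows "qpoch_inf A p = (\<Prod>i<n. qpoch_inf (A * p ^ i) (p ^ n))"
proof -
  have pn: "norm (p ^ n) < 1"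
    using assms by (simp add: norm_power power_less_one_iff)
  \<comment> \<open>Partial products of length \<open>N * n\<close> have the same limit and contain
    every residue class exactly \<open>N\<close> times.\<close>
  have "(\<lambda>N. \<Prod>k<N * n. 1 - A * p ^ k) \<longlonglongrightarrow> qpoch_inf A p"
    by (rule filterlim_compose[OF qpoch_inf_LIMSEQ[OF assms(1)]])
       (use assms(2) in \<open>simp add: filterlim_at_top_mult_tendsto_pos mult_nat_left_at_top mult_nat_right_at_top\<close>)
  moreover have "(\<Prod>k<N * n. 1 - A * p ^ k) = (\<Prod>i<n. \<Prod>m<N. 1 - (A * p ^ i) * (p ^ n) ^ m)" for N
  proof -
    have "(\<Prod>k<N * n. 1 - A * p ^ k) = (\<Prod>m<N. \<Prod>k=m*n..<m*n+n. 1 - A * p ^ k)"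
      by (rule prod.nat_group[symmetric])
    also have "\<dots> = (\<Prod>m<N. \<Prod>i<n. 1 - (A * p ^ i) * (p ^ n) ^ m)"
    proof (rule prod.cong[OF refl])
      fix m
      show "(\<Prod>k=m*n..<m*n+n. 1 - A * p ^ k) = (\<Prod>i<n. 1 - (A * p ^ i) * (p ^ n) ^ m)"
        by (rule prod.reindex_bij_witness[of _ "\<lambda>i. m * n + i" "\<lambda>k. k - m * n"])
           (auto simp: power_add[symmetric] power_mult[symmetric] algebra_simps)
    qed
    finally show ?thesis
      by (subst prod.swap)
  qed
  moreover have "(\<lambda>N. \<Prod>i<n. \<Prod>m<N. 1 - (A * p ^ i) * (p ^ n) ^ m) \<longlonglongrightarrow> (\<Prod>i<n. qpoch_inf (A * p ^ i) (p ^ n))"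
    by (intro tendsto_prod qpoch_inf_LIMSEQ pn)
  ultimately show ?thesis
    using LIMSEQ_unique by fastforce
qed

text \<open>The partial products are polynomials in \<open>q\<close> that converge uniformly on
  closed discs. The constant \<open>c\<close> serves to cover both signs \<open>1\<close> and
  \<open>-1\<close>.\<close>

lemma holomorphic_qpoch_inf:
  assumes "b > 0" "norm c \<le> 1"
  shows "(\<lambda>q. qpoch_inf (c * q ^ a) (q ^ b)) holomorphic_on ball 0 1"
proof (rule holomorphic_uniform_sequence)
  show "open (ball (0::complex) 1)" by simp
  show "(\<lambda>q. \<Prod>k<n. 1 - c * q ^ a * (q ^ b) ^ k) holomorphic_on ball 0 1" for n
    by (intro holomorphic_intros)
  fix z :: complex assume z: "z \<in> ball 0 1"
  then obtain d where d: "d > 0" "cball z d \<subseteq> ball 0 1"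
    using open_contains_cball open_ball by blast
  have "compact (norm ` cball z d)" "norm ` cball z d \<noteq> {}"
    using d(1) by (auto intro!: compact_continuous_image continuous_intros)
  then obtain r where r: "r \<in> norm ` cball z d" "\<And>x. x \<in> cball z d \<Longrightarrow> norm x \<le> r"
    using compact_attains_sup[of "norm ` cball z d"] by (metis imageI)
  then have r1: "0 \<le> r" "r < 1"
    using d(2) by auto
  have "uniformly_convergent_on (cball z d) (\<lambda>n q. \<Prod>k<n. 1 - c * q ^ a * (q ^ b) ^ k)"
  proof (rule uniformly_convergent_on_prod')
    show "uniformly_convergent_on (cball z d) (\<lambda>N x. \<Sum>n<N. norm (1 - c * x ^ a * (x ^ b) ^ n - 1))"
    proof (rule Weierstrass_m_test')
      show "summable (\<lambda>n. r ^ n)"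
        using r1 by (simp add: summable_geometric)
      fix n x assume x: "x \<in> cball z d"
      then have x1: "norm x < 1" "norm x \<le> r"
        using d(2) r(2) by auto
      \<comment> \<open>Since \<open>b\<close> is at least 1, a geometric series in the largest
        modulus \<open>r\<close> on the disc is a majorant.\<close>
      have "norm c * norm x ^ a * (norm x ^ b) ^ n \<le> 1 * 1 * (norm x ^ 1) ^ n"
        using x1 assms by (intro mult_mono power_mono power_decreasing power_le_one mult_nonneg_nonneg) auto
      also have "\<dots> \<le> r ^ n"
        using x1 by (simp add: power_mono)
      finally show "norm (norm (1 - c * x ^ a * (x ^ b) ^ n - 1)) \<le> r ^ n"
        by (simp add: norm_mult norm_power)
    qed
  qed (auto intro!: continuous_intros)
  then have L: "uniform_limit (cball z d) (\<lambda>n q. \<Prod>k<n. 1 - c * q ^ a * (q ^ b) ^ k)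
      (\<lambda>q. lim (\<lambda>n. \<Prod>k<n. 1 - c * q ^ a * (q ^ b) ^ k)) sequentially"
    by (simp add: uniformly_convergent_uniform_limit_iff)
  have eq: "lim (\<lambda>n. \<Prod>k<n. 1 - c * x ^ a * (x ^ b) ^ k) = qpoch_inf (c * x ^ a) (x ^ b)"
    if "x \<in> cball z d" for x
  proof (rule limI[OF qpoch_inf_LIMSEQ])
    show "norm (x ^ b) < 1"
      using that d(2) assms by (auto simp: norm_power power_less_one_iff subset_iff)
  qed
  have "uniform_limit (cball z d) (\<lambda>n q. \<Prod>k<n. 1 - c * q ^ a * (q ^ b) ^ k)
      (\<lambda>q. qpoch_inf (c * q ^ a) (q ^ b)) sequentially"
    by (rule iffD1[OF uniform_limit_cong' L]) (use eq in auto)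
  with d show "\<exists>d>0. cball z d \<subseteq> ball 0 1 \<and>
      uniform_limit (cball z d) (\<lambda>n q. \<Prod>k<n. 1 - c * q ^ a * (q ^ b) ^ k)
        (\<lambda>q. qpoch_inf (c * q ^ a) (q ^ b)) sequentially"
    by blast
qed

section \<open>The Jacobi triple product\<close>

text \<open>The finite product (p; p)_n, written with \<open>p * p ^ k\<close> so that it is
  literally a partial product of \<open>qpoch_inf p p\<close>.\<close>

definition qfact :: "complex \<Rightarrow> nat \<Rightarrow> complex" where
  "qfact p n = (\<Prod>k<n. 1 - p * p ^ k)"

lemma qfact_nonzero: "norm p < 1 \<Longrightarrow> qfact p n \<noteq> 0"
proof -
  assume p: "norm p < 1"
  have "p * p ^ k \<noteq> 1" for k
  proof
    assume "p * p ^ k = 1"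
    then have "norm p * norm p ^ k = 1" by (metis norm_mult norm_one norm_power)
    moreover have "norm p * norm p ^ k \<le> norm p * 1"
      using p by (intro mult_left_mono power_le_one) auto
    ultimately show False using p by simp
  qed
  then show ?thesis by (simp add: qfact_def)
qed

text \<open>The Gaussian binomial coefficient. The value 0 for \<open>k > n\<close> lets the Pascal
  rule hold at the upper end.\<close>

definition qbinom :: "complex \<Rightarrow> nat \<Rightarrow> nat \<Rightarrow> complex" where
  "qbinom p n k = (if k \<le> n then qfact p n / (qfact p k * qfact p (n - k)) else 0)"

text \<open>Of the two q-Pascal rules this is the one that matches multiplication by the last factor
  \<open>1 + z * p ^ n\<close> of the product in the q-binomial theorem.\<close>

lemma qbinom_Suc_Suc:
  assumes p: "norm p < 1" and "k \<le> n"
  shows "qbinom p (Suc n) (Suc k) = qbinom p n (Suc k) + p ^ (n - k) * qbinom p n k"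
proof -
  note nz = qfact_nonzero[OF p]
  obtain d where n: "n = k + d" using assms(2) le_Suc_ex by blast
  have S: "qfact p (Suc m) = qfact p m * (1 - p * p ^ m)" for m
    by (simp add: qfact_def)
  show ?thesis
  proof (cases d)
    \<comment> \<open>Here \<open>k = n\<close>, and \<open>qbinom p n (Suc k)\<close> has its
      default value 0.\<close>
    case 0
    then show ?thesis using nz by (simp add: n qbinom_def)
  next
    case (Suc e)
    have S0: "1 - p * p ^ m \<noteq> 0" for m
      using nz[of "Suc m"] by (auto simp: S)
    have *: "Suc (k + e) - k = Suc e" "Suc (Suc (k + e)) - k = Suc (Suc e)" by auto
    show ?thesis
      using nz S0[of k] S0[of e] S0[of "k + e"]
      by (simp add: n Suc qbinom_def S * divide_simps) (simp add: algebra_simps power_add)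
  qed
qed

lemma choose_two_Suc: "Suc k choose 2 = k + (k choose 2)"
  by (simp add: numeral_2_eq_2)

text \<open>Induction on the number of factors; the coefficients on both sides are compared by the
  q-Pascal rule.\<close>

lemma qbinomial_theorem:
  assumes p: "norm p < 1"
  shows "(\<Prod>k<n. 1 + z * p ^ k) = (\<Sum>k\<le>n. qbinom p n k * p ^ (k choose 2) * z ^ k)"
proof (induction n)
  case 0
  then show ?case by (simp add: qbinom_def qfact_def binomial_eq_0)
next
  case (Suc n)
  have "(\<Sum>k\<le>Suc n. qbinom p (Suc n) k * p ^ (k choose 2) * z ^ k)
      = 1 + (\<Sum>k\<le>n. qbinom p (Suc n) (Suc k) * p ^ (Suc k choose 2) * z ^ Suc k)"
    using qfact_nonzero[OF p, of "Suc n"]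
    by (subst sum.atMost_Suc_shift) (simp add: qbinom_def qfact_def binomial_eq_0)
  also have "(\<Sum>k\<le>n. qbinom p (Suc n) (Suc k) * p ^ (Suc k choose 2) * z ^ Suc k)
     = (\<Sum>k\<le>n. qbinom p n (Suc k) * p ^ (Suc k choose 2) * z ^ Suc k
            + z * p ^ n * (qbinom p n k * p ^ (k choose 2) * z ^ k))"
  proof (rule sum.cong[OF refl])
    fix k assume "k \<in> {..n}"
    then obtain d where "n = k + d" using le_Suc_ex by auto
    then show "qbinom p (Suc n) (Suc k) * p ^ (Suc k choose 2) * z ^ Suc k
      = qbinom p n (Suc k) * p ^ (Suc k choose 2) * z ^ Suc k
            + z * p ^ n * (qbinom p n k * p ^ (k choose 2) * z ^ k)"
      by (simp add: qbinom_Suc_Suc[OF p] choose_two_Suc power_add algebra_simps)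
  qed
  also have "\<dots> = (\<Sum>k\<le>n. qbinom p n (Suc k) * p ^ (Suc k choose 2) * z ^ Suc k) 
                 + z * p ^ n * (\<Sum>k\<le>n. qbinom p n k * p ^ (k choose 2) * z ^ k)"
    by (simp add: sum.distrib sum_distrib_left)
  also have "(\<Sum>k\<le>n. qbinom p n (Suc k) * p ^ (Suc k choose 2) * z ^ Suc k) 
      = (\<Sum>k\<le>Suc n. qbinom p n k * p ^ (k choose 2) * z ^ k) - 1"
    using qfact_nonzero[OF p, of n]
    by (subst sum.atMost_Suc_shift) (simp add: qbinom_def qfact_def binomial_eq_0)
  \<comment> \<open>The top term vanishes by the default value of \<open>qbinom\<close>.\<close>
  also have "(\<Sum>k\<le>Suc n. qbinom p n k * p ^ (k choose 2) * z ^ k) 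
      = (\<Sum>k\<le>n. qbinom p n k * p ^ (k choose 2) * z ^ k)"
    by (simp add: qbinom_def)
  finally show ?case
    using Suc.IH by (simp add: algebra_simps)
qed

text \<open>This continues \<open>n choose 2\<close> to negative indices. The division is exact, so
  identities are proved after doubling, by \<open>two_tri\<close>.\<close>

definition tri :: "int \<Rightarrow> int" where
  "tri n = n * (n - 1) div 2"

lemma two_tri: "2 * tri n = n * (n - 1)"
  by (simp add: tri_def)

lemma tri_add: "tri (m + n) = tri m + tri n + m * n"
proof -
  have "2 * tri (m + n) = 2 * (tri m + tri n + m * n)"
    unfolding distrib_left two_tri by (simp add: algebra_simps)
  then show ?thesis by simp
qed

lemma tri_minus: "tri (- n) = tri n + n"
proof -
  have "2 * tri (- n) = 2 * (tri n + n)"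
    unfolding distrib_left two_tri by (simp add: algebra_simps)
  then show ?thesis by simp
qed

lemma tri_of_nat: "tri (int k) = int (k choose 2)"
proof (induction k)
  case (Suc k)
  have "tri (int k + 1) = tri (int k) + int k"
    by (subst tri_add) (simp add: tri_def)
  with Suc show ?case by (simp add: choose_two_Suc add.commute)
qed (simp add: tri_def)

text \<open>The modified Jacobi theta function. The factor (p; p)_infinity is left out, so that
  theta quotients are quotients of the products occurring in the theorem.\<close>

definition theta :: "complex \<Rightarrow> complex \<Rightarrow> complex" where
  "theta x p = qpoch_inf x p * qpoch_inf (p / x) p"

definition theta_term :: "complex \<Rightarrow> complex \<Rightarrow> int \<Rightarrow> complex" where
  "theta_term x p n = (-1) powi n * x powi n * p powi tri n"

lemma prod_lessThan_double: "(\<Prod>k<2*N. f k) = (\<Prod>k<N. f k) * (\<Prod>k<N. f (N + k))" for f :: "nat \<Rightarrow> complex"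
proof -
  have "{..<2*N} = {..<N} \<union> {N..<2*N}" by auto
  then have "(\<Prod>k<2*N. f k) = (\<Prod>k<N. f k) * (\<Prod>k=N..<2*N. f k)"
    by (metis prod.union_disjoint finite_lessThan finite_atLeastLessThan ivl_disj_int_one(2))
  also have "(\<Prod>k=N..<2*N. f k) = (\<Prod>k<N. f (N + k))"
    by (rule prod.reindex_bij_witness[of _ "\<lambda>k. N + k" "\<lambda>k. k - N"]) auto
  finally show ?thesis .
qed

text \<open>This is the q-binomial theorem with \<open>2 * N\<close> factors, recentred at the index
  \<open>N\<close>. The upper half of the product is the first product on the left; the lower half,
  reversed, is the second up to the monomial \<open>W\<close>.\<close>

lemma finite_triple_product:
  assumes p: "norm p < 1" "p \<noteq> 0" and x: "x \<noteq> 0"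
  shows "(\<Prod>k<N. 1 - x * p ^ k) * (\<Prod>k<N. 1 - (p / x) * p ^ k)
       = (\<Sum>n\<in>{- int N..int N}. qbinom p (2 * N) (nat (int N + n)) * theta_term x p n)"
proof -
  \<comment> \<open>With this \<open>z\<close> the factor of index \<open>N + k\<close> becomes
    \<open>1 - x * p ^ k\<close>.\<close>
  define z where "z = - x / p ^ N"
  define W where "W = (\<Prod>k<N. - x / p ^ Suc k)"
  have Wn: "(\<Prod>k<m. - x / p ^ Suc k) = (-1) powi m * x powi m * p powi (- (tri m + m))" for m
  proof (induction m)
    case (Suc m)
    have "tri (int m + 1) = tri m + m" by (subst tri_add) (simp add: tri_def)
    then have e: "- (tri (int (Suc m)) + int (Suc m)) = - (tri m + m) + - (int (Suc m))"
      by (simp add: add.commute)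
    have "p powi (- (tri (int (Suc m)) + int (Suc m))) = p powi (- (tri m + m)) * p powi (- (int (Suc m)))"
      unfolding e by (rule power_int_add) (use p in simp)
    moreover have "p powi (- (int (Suc m))) = 1 / p ^ Suc m"
      by (simp only: power_int_minus power_int_of_nat inverse_eq_divide)
    ultimately show ?case
      using Suc by (simp only: prod.lessThan_Suc power_int_of_nat) simp
  qed (simp add: tri_def)
  have W: "W = (-1) powi N * x powi N * p powi (- (tri N + N))"
    unfolding W_def by (rule Wn)
  then have W0: "W \<noteq> 0" using p x by (simp add: power_int_eq_0_iff)
  have "(\<Prod>k<N. 1 + z * p ^ k) = (\<Prod>k<N. 1 + z * p ^ (N - Suc k))"
    by (rule prod.nat_diff_reindex[symmetric])
  also have "\<dots> = (\<Prod>k<N. - x / p ^ Suc k * (1 - (p / x) * p ^ k))"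
  proof (rule prod.cong[OF refl])
    fix k assume "k \<in> {..<N}"
    then obtain d where d: "N = Suc k + d" by (metis lessThan_iff less_iff_Suc_add add_Suc)
    then show "1 + z * p ^ (N - Suc k) = - x / p ^ Suc k * (1 - (p / x) * p ^ k)"
      using p x by (simp add: z_def field_simps power_add)
  qed
  also have "\<dots> = W * (\<Prod>k<N. 1 - (p / x) * p ^ k)"
    by (simp only: prod.distrib W_def)
  finally have 1: "(\<Prod>k<N. 1 + z * p ^ k) = W * (\<Prod>k<N. 1 - (p / x) * p ^ k)" .
  have 2: "(\<Prod>k<N. 1 + z * p ^ (N + k)) = (\<Prod>k<N. 1 - x * p ^ k)"
    using p by (simp add: z_def power_add)
  have "W * ((\<Prod>k<N. 1 - x * p ^ k) * (\<Prod>k<N. 1 - (p / x) * p ^ k)) = (\<Prod>k<2*N. 1 + z * p ^ k)"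
    by (simp add: prod_lessThan_double 1 2)
  also have "\<dots> = (\<Sum>k\<le>2*N. qbinom p (2*N) k * p ^ (k choose 2) * z ^ k)"
    by (rule qbinomial_theorem[OF p(1)])
  also have "\<dots> = (\<Sum>n\<in>{- int N..int N}. W * (qbinom p (2 * N) (nat (int N + n)) * theta_term x p n))"
  proof (rule sum.reindex_bij_witness[of _ "\<lambda>n. nat (int N + n)" "\<lambda>k. int k - int N"])
    fix k assume "k \<in> {..2*N}"
    \<comment> \<open>Shifting the index by \<open>N\<close> produces exactly the exponents of
      \<open>W\<close> besides those of the theta term.\<close>
    have e: "tri (int k - int N) = int (k choose 2) + tri (int N) + int N - int k * int N"
      using tri_add[of "int k" "- int N"] by (simp add: tri_minus tri_of_nat)
    have "p ^ (k choose 2) * z ^ k = (-1) ^ k * x ^ k * (p powi (int (k choose 2)) * p powi (- (int N * int k)))"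
      by (simp add: z_def power_divide power_minus[of "x / p ^ N"] power_int_minus field_simps power_mult[symmetric] 
          flip: of_nat_mult)
    also have "\<dots> = (-1) ^ k * x ^ k * p powi (- (tri N + N) + tri (int k - int N))"
    proof -
      have "- (tri N + N) + tri (int k - int N) = int (k choose 2) + - (int N * int k)"
        by (simp add: e algebra_simps)
      then show ?thesis
        using p(2) by (metis power_int_add)
    qed
    also have "\<dots> = W * theta_term x p (int k - int N)"
      using p x by (simp add: W theta_term_def power_int_add power_int_diff)
    finally show "W * (qbinom p (2 * N) (nat (int N + (int k - int N))) * theta_term x p (int k - int N)) 
       = qbinom p (2*N) k * p ^ (k choose 2) * z ^ k"
      by (simp add: algebra_simps)
  qed auto
  also have "\<dots> = W * (\<Sum>n\<in>{- int N..int N}. qbinom p (2 * N) (nat (int N + n)) * theta_term x p n)"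
    by (simp add: sum_distrib_left)
  finally show ?thesis using W0 by simp
qed

text \<open>Consecutive terms have the ratio \<open>r ^ n * y\<close>, which tends to 0 however
  large \<open>y\<close> is.\<close>

lemma summable_theta_nat:
  fixes r y :: real
  assumes "0 \<le> r" "r < 1"
  shows "summable (\<lambda>n. r ^ (n choose 2) * y ^ n)"
proof -
  have "(\<lambda>n. r ^ n * norm y) \<longlonglongrightarrow> 0 * norm y"
    using assms by (intro tendsto_intros LIMSEQ_realpow_zero)
  then have "\<forall>\<^sub>F n in sequentially. r ^ n * norm y < 1/2"
    by (intro order_tendstoD(2)[where y = 0]) auto
  then obtain N where N: "\<And>n. n \<ge> N \<Longrightarrow> r ^ n * norm y < 1/2"
    by (auto simp: eventually_sequentially)
  show ?thesis
  proof (rule summable_ratio_test[of "1/2" N])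
    fix n assume "n \<ge> N"
    have "norm (r ^ (Suc n choose 2) * y ^ Suc n) = (r ^ n * norm y) * norm (r ^ (n choose 2) * y ^ n)"
      using assms by (simp add: choose_two_Suc power_add abs_mult)
    also have "\<dots> \<le> 1/2 * norm (r ^ (n choose 2) * y ^ n)"
      using N[OF \<open>n \<ge> N\<close>] by (intro mult_right_mono) auto
    finally show "norm (r ^ (Suc n choose 2) * y ^ Suc n) \<le> 1/2 * norm (r ^ (n choose 2) * y ^ n)" .
  qed simp
qed

text \<open>The nonpositive indices give a series of the same shape as the nonnegative ones, with
  \<open>norm p / norm x\<close> in place of \<open>norm x\<close>.\<close>

lemma theta_term_abs_summable:
  assumes p: "norm p < 1" "p \<noteq> 0" and x: "x \<noteq> 0"
  shows "(\<lambda>n. norm (theta_term x p n)) summable_on UNIV"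
proof -
  have pos: "norm (theta_term x p (int k)) = norm p ^ (k choose 2) * norm x ^ k" for k
    by (simp add: theta_term_def tri_of_nat norm_mult norm_power)
  have neg: "norm (theta_term x p (- int k)) = norm p ^ (k choose 2) * (norm p / norm x) ^ k" for k
    using p x by (simp add: theta_term_def tri_minus tri_of_nat norm_mult norm_power norm_divide
        power_int_minus power_int_add field_simps)
  have "(\<lambda>n. norm (theta_term x p n)) summable_on range int"
    by (subst summable_on_reindex)
       (auto simp: inj_on_def o_def pos intro!: norm_summable_imp_summable_on summable_norm summable_theta_nat p
             simp: norm_mult norm_power)
  moreover have "(\<lambda>n. norm (theta_term x p n)) summable_on range (\<lambda>k. - int k)"
  proof (subst summable_on_reindex)
    have "summable (\<lambda>k. norm (norm p ^ (k choose 2) * (norm p / norm x) ^ k))"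
      using summable_theta_nat[of "norm p" "norm p / norm x"] p by (simp add: abs_mult)
    then show "(\<lambda>n. norm (theta_term x p n)) \<circ> (\<lambda>k. - int k) summable_on UNIV"
      unfolding o_def neg by (rule norm_summable_imp_summable_on)
  qed (auto simp: inj_on_def)
  moreover have "range int \<union> range (\<lambda>k. - int k) = UNIV"
    by (auto simp: image_iff) (metis int_cases2)
  ultimately show ?thesis
    using summable_on_union by metis
qed

text \<open>The limit of \<open>finite_triple_product\<close>: each Gaussian coefficient tends to
  \<open>1 / E\<close>, and Tannery's theorem allows the limit to be taken term by term.\<close>

theorem jacobi_triple_product:
  assumes p: "norm p < 1" "p \<noteq> 0" and x: "x \<noteq> 0"
  shows "(theta_term x p has_sum qpoch_inf p p * theta x p) UNIV"
proof -
  define E where "E = qpoch_inf p p"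
  \<comment> \<open>Tannery's theorem concerns series over the naturals, so the integers are
    enumerated by \<open>int_decode\<close>.\<close>
  define f where "f = (\<lambda>k. theta_term x p (int_decode k))"
  \<comment> \<open>Continuation by zero turns the finite sums for all \<open>N\<close> into series
    over one index set.\<close>
  define c where "c = (\<lambda>n N. if n \<in> {- int N..int N} then qbinom p (2 * N) (nat (int N + n)) else 0)"
  have bij: "bij int_decode"
    by (simp add: bij_def inj_int_decode surj_int_decode)
  have E0: "E \<noteq> 0" unfolding E_def using p by (intro qpoch_inf_nonzero)
  have qf: "qfact p \<longlonglongrightarrow> E"
    unfolding qfact_def E_def by (rule qpoch_inf_LIMSEQ[OF p(1)])
  have qfi: "(\<lambda>n. 1 / qfact p n) \<longlonglongrightarrow> 1 / E"
    by (intro tendsto_intros qf E0)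
  obtain B where B: "\<And>n. norm (qfact p n) \<le> B"
    using convergent_imp_Bseq[OF convergentI[OF qf]] by (auto simp: Bseq_def)
  obtain C where C: "\<And>n. norm (1 / qfact p n) \<le> C"
    using convergent_imp_Bseq[OF convergentI[OF qfi]] by (auto simp: Bseq_def)
  have BC: "0 \<le> B" "0 \<le> C" using B C norm_ge_zero order_trans by blast+
  \<comment> \<open>The values of \<open>qfact p\<close> and their reciprocals converge, hence are
    bounded; this gives a bound uniform in \<open>n\<close> and \<open>N\<close>.\<close>
  have bound: "norm (c n N) \<le> B * C * C" for n N
  proof -
    have "norm (qfact p a / (qfact p b * qfact p d)) \<le> B * C * C" for a b d
      using mult_mono[OF mult_mono[OF B[of a] C[of b]] C[of d]] BC
      by (simp add: norm_divide norm_mult)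
    then show ?thesis using BC by (auto simp: c_def qbinom_def)
  qed
  have lim: "(\<lambda>N. c n N) \<longlonglongrightarrow> 1 / E" for n
  proof -
    have l1: "LIM N sequentially. 2 * N :> at_top"
      by (rule mult_nat_left_at_top) simp
    have l2: "LIM N sequentially. nat (int N + n) :> at_top"
      unfolding filterlim_at_top eventually_sequentially
      by (intro allI, rule_tac x = "Z + nat \<bar>n\<bar>" in exI) auto
    have l3: "LIM N sequentially. 2 * N - nat (int N + n) :> at_top"
      unfolding filterlim_at_top eventually_sequentially
      by (intro allI, rule_tac x = "Z + nat \<bar>n\<bar>" in exI) auto
    have "(\<lambda>N. qfact p (2 * N) / (qfact p (nat (int N + n)) * qfact p (2 * N - nat (int N + n))))
       \<longlonglongrightarrow> E / (E * E)"
      by (intro tendsto_intros filterlim_compose[OF qf] l1 l2 l3) (use E0 in auto)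
    moreover have "\<forall>\<^sub>F N in sequentially. c n N = 
        qfact p (2 * N) / (qfact p (nat (int N + n)) * qfact p (2 * N - nat (int N + n)))"
      unfolding eventually_sequentially
      by (rule exI[of _ "nat \<bar>n\<bar>"]) (auto simp: c_def qbinom_def)
    ultimately show ?thesis
      using E0 by (simp add: tendsto_cong)
  qed
  have sf: "summable (\<lambda>k. norm (f k))"
  proof (rule summable_on_imp_summable)
    show "(\<lambda>k. norm (f k)) summable_on UNIV"
      unfolding f_def using summable_on_reindex_bij_betw[OF bij, of "\<lambda>n. norm (theta_term x p n)"]
        theta_term_abs_summable[OF assms] by simp
  qed
  have fin: "(\<Sum>k. c (int_decode k) N * f k) = (\<Prod>k<N. 1 - x * p ^ k) * (\<Prod>k<N. 1 - (p / x) * p ^ k)" for N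
  proof -
    let ?K = "int_encode ` {- int N..int N}"
    have "(\<Sum>k. c (int_decode k) N * f k) = (\<Sum>k\<in>?K. c (int_decode k) N * f k)"
    proof (rule suminf_finite)
      fix k assume "k \<notin> ?K"
      then have "int_decode k \<notin> {- int N..int N}"
        by (metis image_eqI int_decode_inverse)
      then show "c (int_decode k) N * f k = 0"
        by (simp only: c_def if_not_P mult_zero_left not_False_eq_True)
    qed simp
    also have "\<dots> = (\<Sum>n\<in>{- int N..int N}. c n N * theta_term x p n)"
      by (subst sum.reindex) (auto simp: f_def inj_int_encode)
    also have "\<dots> = (\<Prod>k<N. 1 - x * p ^ k) * (\<Prod>k<N. 1 - (p / x) * p ^ k)"
      unfolding finite_triple_product[OF assms] by (rule sum.cong) (auto simp: c_def)
    finally show ?thesis .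
  qed
  have "(\<lambda>N. \<Sum>k. c (int_decode k) N * f k) \<longlonglongrightarrow> (\<Sum>k. 1 / E * f k)"
  proof (rule tannerys_theorem[THEN conjunct2, THEN conjunct2])
    show "(\<lambda>N. c (int_decode k) N * f k) \<longlonglongrightarrow> 1 / E * f k" for k
      by (intro tendsto_intros lim)
    show "\<forall>\<^sub>F (k, N) in sequentially \<times>\<^sub>F sequentially. norm (c (int_decode k) N * f k) \<le> B * C * C * norm (f k)"
      by (intro always_eventually) (auto simp: norm_mult intro!: mult_right_mono bound)
    show "summable (\<lambda>k. B * C * C * norm (f k))"
      by (intro summable_mult sf)
  qed simp
  moreover have "(\<lambda>N. \<Sum>k. c (int_decode k) N * f k) \<longlonglongrightarrow> theta x p"
    unfolding fin theta_def by (intro tendsto_intros qpoch_inf_LIMSEQ p)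
  ultimately have "(\<Sum>k. 1 / E * f k) = theta x p"
    using LIMSEQ_unique by blast
  moreover have "(\<Sum>k. 1 / E * f k) = 1 / E * (\<Sum>k. f k)"
    by (rule suminf_mult[OF summable_norm_cancel[OF sf]])
  ultimately have "suminf f = E * theta x p"
    using E0 by (simp add: field_simps)
  then have "(f has_sum E * theta x p) UNIV"
    using norm_summable_imp_has_sum[OF sf summable_sums[OF summable_norm_cancel[OF sf]]] by simp
  then show ?thesis
    unfolding f_def E_def using has_sum_reindex_bij_betw[OF bij, of "theta_term x p"] by simp
qed

section \<open>The three-term relation\<close>

lemma theta_reflect: "p \<noteq> 0 \<Longrightarrow> x \<noteq> 0 \<Longrightarrow> theta (p / x) p = theta x p"
  by (simp add: theta_def mult.commute)

lemma theta_inverse: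
  assumes "norm p < 1" "x \<noteq> 0"
  shows "theta (1 / x) p = - theta x p / x"
proof -
  define Y where "Y = qpoch_inf (x * p) p * qpoch_inf (1 / x * p) p"
  have A: "theta (1 / x) p = (1 - 1 / x) * Y"
    using qpoch_inf_rec[OF assms(1), of "1 / x"] by (simp add: theta_def Y_def mult.commute)
  have B: "theta x p = (1 - x) * Y"
    using qpoch_inf_rec[OF assms(1), of x] by (simp add: theta_def Y_def)
  show ?thesis
    unfolding A B using assms(2) by (simp add: field_simps)
qed

lemma theta_mult_base:
  assumes "norm p < 1" "x \<noteq> 0" "p \<noteq> 0"
  shows "theta (p * x) p = - theta x p / x"
  using theta_reflect[of p "1 / x"] theta_inverse[OF assms(1,2)] assms by simp

text \<open>Iterated quasi-periodicity. In the quintuple product it reduces infinitely many theta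
  arguments to three.\<close>

lemma theta_mult_base_powi:
  assumes "norm p < 1" "x \<noteq> 0" "p \<noteq> 0"
  shows "theta (p powi m * x) p = (-1) powi m * x powi (- m) * p powi (- tri m) * theta x p"
proof (induction m rule: int_induct[of _ 0])
  case base
  then show ?case by (simp add: tri_def)
next
  case (step1 m)
  have t: "tri (m + 1) = tri m + m" by (subst tri_add) (simp add: tri_def)
  have "theta (p powi (m + 1) * x) p = - theta (p powi m * x) p / (p powi m * x)"
    using theta_mult_base[OF assms(1) _ assms(3), of "p powi m * x"] assms
    by (simp add: power_int_add mult_ac)
  also have "\<dots> = - ((-1) powi m * x powi (- m) * p powi (- tri m) * theta x p) / (p powi m * x)"
    using step1 by simp
  also have "\<dots> = (-1) powi (m + 1) * x powi (- (m + 1)) * p powi (- tri (m + 1)) * theta x p"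
    using assms unfolding t by (simp add: power_int_add power_int_minus power_int_diff divide_simps)
  finally show ?case .
next
  case (step2 m)
  have t: "tri m = tri (m - 1) + (m - 1)"
    using tri_add[of "m - 1" 1] by (simp add: tri_def)
  have "theta (p powi m * x) p = - theta (p powi (m - 1) * x) p / (p powi (m - 1) * x)"
    using theta_mult_base[OF assms(1) _ assms(3), of "p powi (m - 1) * x"] assms
    by (simp add: power_int_diff mult_ac)
  then have "theta (p powi (m - 1) * x) p = - (p powi (m - 1) * x) * theta (p powi m * x) p"
    using assms by (simp add: field_simps)
  also have "\<dots> = - (p powi (m - 1) * x) * ((-1) powi m * x powi (- m) * p powi (- tri m) * theta x p)"
    using step2 by simp
  also have "\<dots> = (-1) powi (m - 1) * x powi (- (m - 1)) * p powi (- tri (m - 1)) * theta x p"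
    using assms unfolding t by (simp add: power_int_add power_int_minus power_int_diff divide_simps)
  finally show ?case .
qed

lemma theta_mult_minus:
  assumes "norm p < 1"
  shows "theta x p * theta (- x) p = theta (x^2) (p^2)"
proof -
  have "theta x p * theta (- x) p
      = (qpoch_inf x p * qpoch_inf (- x) p) * (qpoch_inf (p / x) p * qpoch_inf (- (p / x)) p)"
    by (simp add: theta_def)
  also have "\<dots> = theta (x^2) (p^2)"
    unfolding qpoch_inf_mult_minus[OF assms] by (simp add: theta_def power_divide)
  finally show ?thesis .
qed

text \<open>Both products are split by the parity of the index, and the four factors are paired
  crosswise.\<close>

lemma theta_bisection:
  assumes "norm p < 1" "x \<noteq> 0" "p \<noteq> 0"
  shows "theta x p = theta x (p^2) * theta (p * x) (p^2)"
  using qpoch_inf_multisection[OF assms(1), of 2 x] qpoch_inf_multisection[OF assms(1), of 2 "p / x"] assms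
  by (simp add: theta_def lessThan_Suc numeral_2_eq_2 mult_ac)

section \<open>Products of two theta series\<close>

lemma has_sum_mult_Times:
  fixes f g :: "int \<Rightarrow> complex"
  assumes f: "(f has_sum a) A" and g: "(g has_sum b) B"
    and nf: "(\<lambda>x. norm (f x)) summable_on A" and ng: "(\<lambda>x. norm (g x)) summable_on B"
  shows "((\<lambda>(x, y). f x * g y) has_sum a * b) (A \<times> B)"
proof (rule has_sum_SigmaI)
  show "((\<lambda>y. case (x, y) of (x, y) \<Rightarrow> f x * g y) has_sum f x * b) B" for x
    using has_sum_cmult_right[OF g] by simp
  show "((\<lambda>x. f x * b) has_sum a * b) A"
    by (rule has_sum_cmult_left[OF f])
  have "(\<lambda>(x, y). norm (f x) * norm (g y)) summable_on A \<times> B"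
  proof (rule summable_on_SigmaI)
    show "((\<lambda>y. case (x, y) of (x, y) \<Rightarrow> norm (f x) * norm (g y)) has_sum norm (f x) * infsum (\<lambda>y. norm (g y)) B) B" for x
      using has_sum_cmult_right[OF has_sum_infsum[OF ng]] by simp
    show "(\<lambda>x. norm (f x) * infsum (\<lambda>y. norm (g y)) B) summable_on A"
      by (rule summable_on_cmult_left[OF nf])
  qed auto
  then show "(\<lambda>(x, y). f x * g y) summable_on A \<times> B"
    by (rule abs_summable_summable[OF back_subst[of "\<lambda>f. f summable_on A \<times> B"]])
       (simp add: case_prod_unfold norm_mult)
qed

lemma theta_terms_has_sum:
  assumes "norm p < 1" "p \<noteq> 0" "x \<noteq> 0" "norm r < 1" "r \<noteq> 0" "y \<noteq> 0"
  shows "((\<lambda>(i, j). theta_term x p i * theta_term y r j) has_sum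
          (qpoch_inf p p * theta x p) * (qpoch_inf r r * theta y r)) (UNIV \<times> UNIV)"
  by (rule has_sum_mult_Times[OF jacobi_triple_product jacobi_triple_product
        theta_term_abs_summable theta_term_abs_summable]) (use assms in auto)

lemma power_int_square: "(x^2) powi n = x powi (2 * n)" for x :: complex
  using power_int_mult[of x 2 n] by simp

lemma minus_one_powi_double: "(-1) powi (2 * n) = (1::complex)"
  by (simp add: power_int_mult)

lemma theta_term_mult:
  assumes "x \<noteq> 0" "y \<noteq> 0" "p \<noteq> 0"
  shows "theta_term (x * y) p i * theta_term (x / y) p j
       = (-1) powi (i + j) * x powi (i + j) * y powi (i - j) * p powi (tri i + tri j)"
  using assms
  by (simp add: theta_term_def power_int_add power_int_diff power_int_mult_distrib power_int_divide_distrib)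

lemma theta_term_minus: "theta_term (- z) (p^2) n = z powi n * p powi (2 * tri n)"
proof -
  have "(- z) powi n = (-1) powi n * z powi n"
    using power_int_mult_distrib[of "-1" z n] by simp
  moreover have "(-1) powi n * (-1) powi n = (1 :: complex)"
    by (simp flip: power_int_mult_distrib)
  ultimately show ?thesis
    by (simp add: theta_term_def power_int_square flip: mult.assoc)
qed

text \<open>Sorting the double series of a product of two theta functions by the parity of the
  sum of the indices separates the variables. The result is a determinant of rank two, so that
  the three-term relation below is a Pluecker relation.\<close>

lemma theta_mult_theta:
  assumes p: "norm p < 1" "p \<noteq> 0" and x: "x \<noteq> 0" and y: "y \<noteq> 0"
  shows "(qpoch_inf p p)^2 * (theta (x * y) p * theta (x / y) p) =
    (qpoch_inf (p^2) (p^2))^2 * (theta (- (x^2)) (p^2) * theta (- (p * y^2)) (p^2)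
       - x * y * theta (- (p * x^2)) (p^2) * theta (- (p^2 * y^2)) (p^2))"
proof -
  let ?E = "qpoch_inf (p^2) (p^2)"
  let ?f = "\<lambda>(i, j). theta_term (x * y) p i * theta_term (x / y) p j"
  let ?g = "\<lambda>(m, n). theta_term (- (x^2)) (p^2) m * theta_term (- (p * y^2)) (p^2) n"
  let ?h = "\<lambda>(m, n). - (x * y) * (theta_term (- (p * x^2)) (p^2) m * theta_term (- (p^2 * y^2)) (p^2) n)"
  have p2: "norm (p^2) < 1" "p^2 \<noteq> 0"
    using p by (auto simp: norm_power power_less_one_iff)
  have t: "tri (m + n) + tri (m - n) = 2 * tri m + 2 * tri n + n" for m n
    using tri_add[of m n] tri_add[of m "- n"] by (simp add: tri_minus)
  have t': "tri (m + n + 1) + tri (m - n) = 2 * tri m + m + (2 * tri n + 2 * n)" for m n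
    using tri_add[of "m + n" 1] t[of m n] by (simp add: tri_def[of 1])
  \<comment> \<open>For even \<open>i - j\<close> the substitution \<open>i = m + n\<close>,
    \<open>j = m - n\<close> leaves \<open>x\<close> attached to \<open>m\<close> only and
    \<open>y\<close> to \<open>n\<close> only.\<close>
  have eq: "?g (m, n) = ?f (m + n, m - n)" for m n
    unfolding prod.case theta_term_mult[OF x y p(2)] theta_term_minus t using p x y
    by (simp add: power_int_mult_distrib power_int_square minus_one_powi_double power_int_add)
  \<comment> \<open>For odd \<open>i - j\<close> the extra 1 in \<open>i\<close> leaves one unpaired
    sign and one factor \<open>x * y\<close>.\<close>
  have eq': "?h (m, n) = ?f (m + n + 1, m - n)" for m n
  proof -
    have "?f (m + n + 1, m - n) = (-1) powi (2 * m + 1) * x powi (2 * m + 1) * y powi (2 * n + 1)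
        * p powi (2 * tri m + m + (2 * tri n + 2 * n))"
      unfolding prod.case theta_term_mult[OF x y p(2)] t' by (simp add: add_ac)
    also have "\<dots> = ?h (m, n)"
      unfolding prod.case theta_term_minus using p x y
      by (simp add: power_int_mult_distrib power_int_square minus_one_powi_double power_int_add)
    finally show ?thesis ..
  qed
  have "(?f has_sum (qpoch_inf p p * theta (x * y) p) * (qpoch_inf p p * theta (x / y) p)) UNIV"
    using theta_terms_has_sum[of p "x * y" p "x / y"] assms by simp
  moreover have "(?f has_sum (?E * theta (- (x^2)) (p^2)) * (?E * theta (- (p * y^2)) (p^2))
      + - (x * y) * ((?E * theta (- (p * x^2)) (p^2)) * (?E * theta (- (p^2 * y^2)) (p^2)))) 
      ({(i, j). even (i - j)} \<union> {(i, j). odd (i - j)})"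
  proof (rule has_sum_Un_disjoint)
    have "(?g has_sum (?E * theta (- (x^2)) (p^2)) * (?E * theta (- (p * y^2)) (p^2))) UNIV"
      using theta_terms_has_sum[of "p^2" "- (x^2)" "p^2" "- (p * y^2)"] assms p2 by simp
    moreover have "bij_betw (\<lambda>(m, n). (m + n, m - n)) UNIV {(i, j). even (i - j :: int)}"
      by (rule bij_betw_byWitness[where f' = "\<lambda>(i, j). ((i + j) div 2, (i - j) div 2)"])
         (auto, presburger+)
    ultimately show "(?f has_sum (?E * theta (- (x^2)) (p^2)) * (?E * theta (- (p * y^2)) (p^2)))
        {(i, j). even (i - j)}"
      by (subst has_sum_reindex_bij_betw[symmetric]) (auto simp: eq[unfolded prod.case, symmetric] case_prod_unfold)
  next
    have "(?h has_sum - (x * y) * ((?E * theta (- (p * x^2)) (p^2)) * (?E * theta (- (p^2 * y^2)) (p^2)))) UNIV"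
      using has_sum_cmult_right[OF theta_terms_has_sum[of "p^2" "- (p * x^2)" "p^2" "- (p^2 * y^2)"],
        of "- (x * y)"] assms p2 by (simp add: case_prod_unfold)
    moreover have "bij_betw (\<lambda>(m, n). (m + n + 1, m - n)) UNIV {(i, j). odd (i - j :: int)}"
      by (rule bij_betw_byWitness[where f' = "\<lambda>(i, j). ((i + j) div 2, (i - j) div 2)"])
         (auto, presburger+)
    ultimately show "(?f has_sum - (x * y) * ((?E * theta (- (p * x^2)) (p^2)) * (?E * theta (- (p^2 * y^2)) (p^2))))
        {(i, j). odd (i - j)}"
      by (subst has_sum_reindex_bij_betw[symmetric]) (auto simp: eq'[unfolded prod.case, symmetric] case_prod_unfold)
  qed auto
  moreover have "{(i, j). even (i - j :: int)} \<union> {(i, j). odd (i - j)} = UNIV" by auto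
  ultimately have "(qpoch_inf p p * theta (x * y) p) * (qpoch_inf p p * theta (x / y) p)
    = (?E * theta (- (x^2)) (p^2)) * (?E * theta (- (p * y^2)) (p^2))
      + - (x * y) * ((?E * theta (- (p * x^2)) (p^2)) * (?E * theta (- (p^2 * y^2)) (p^2)))"
    using has_sum_unique by metis
  then show ?thesis
    by (simp add: power2_eq_square algebra_simps)
qed

text \<open>Weierstrass's addition formula. Up to the factor \<open>a / c\<close>, each product
  \<open>theta (a * b) p * theta (a / b) p\<close> is the determinant of the vectors
  (\<open>A a\<close>, \<open>B a\<close>) and (\<open>A b\<close>, \<open>B b\<close>), and the
  minors of four such vectors satisfy the Pluecker relation.\<close>

theorem theta_three_term:
  assumes p: "norm p < 1" "p \<noteq> 0" and nz: "x \<noteq> 0" "y \<noteq> 0" "u \<noteq> 0" "v \<noteq> 0"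
  shows "theta (x * y) p * theta (x / y) p * (theta (u * v) p * theta (u / v) p)
       - theta (x * v) p * theta (x / v) p * (theta (u * y) p * theta (u / y) p)
       = u / y * (theta (y * v) p * theta (y / v) p * (theta (x * u) p * theta (x / u) p))"
proof -
  define c where "c = (qpoch_inf p p / qpoch_inf (p^2) (p^2))^2"
  define A where "A = (\<lambda>y. theta (- (p * y^2)) (p^2))"
  define B where "B = (\<lambda>y. y * theta (- (p^2 * y^2)) (p^2))"
  have p2: "norm (p^2) < 1" "p^2 \<noteq> 0"
    using p by (auto simp: norm_power power_less_one_iff)
  have E0: "qpoch_inf p p \<noteq> 0" "qpoch_inf (p^2) (p^2) \<noteq> 0"
    using qpoch_inf_nonzero[OF p(1) p(1)] qpoch_inf_nonzero[OF p2(1) p2(1)] by auto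
  then have c0: "c \<noteq> 0" by (simp add: c_def)
  have D: "theta (a * b) p * theta (a / b) p = a * (B a * A b - A a * B b) / c"
    if "a \<noteq> 0" "b \<noteq> 0" for a b
  proof -
    \<comment> \<open>Quasi-periodicity reduces the four functions in
      \<open>theta_mult_theta\<close> to the two functions \<open>A\<close> and
      \<open>B\<close>.\<close>
    have "theta (- (p^2 * a^2)) (p^2) = theta (- (a^2)) (p^2) / a^2"
      using theta_mult_base[OF p2(1) _ p2(2), of "- (a^2)"] that by simp
    then have "theta (- (a^2)) (p^2) = a * B a"
      using that by (simp add: B_def field_simps power2_eq_square)
    then have "theta (- (a^2)) (p^2) * A b - a * b * A a * theta (- (p^2 * b^2)) (p^2)
       = a * (B a * A b - A a * B b)"
      by (simp add: B_def algebra_simps)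
    then have "(qpoch_inf p p)^2 * (theta (a * b) p * theta (a / b) p)
      = (qpoch_inf (p^2) (p^2))^2 * (a * (B a * A b - A a * B b))"
      unfolding theta_mult_theta[OF p that] by (simp add: A_def)
    then show ?thesis
      using E0 by (simp add: c_def field_simps)
  qed
  show ?thesis
    unfolding D[OF nz(1,2)] D[OF nz(3,4)] D[OF nz(1,4)] D[OF nz(3,2)] D[OF nz(2,4)] D[OF nz(1,3)]
    using c0 nz(2) by (simp add: field_simps)
qed

section \<open>The quintuple product and the dissection of the Euler function\<close>

lemma infsum_residue_classes:
  fixes f :: "int \<Rightarrow> complex"
  assumes f: "f summable_on UNIV" and k: "k > 0"
  shows "infsum f UNIV = (\<Sum>r\<in>{0..<k}. \<Sum>\<^sub>\<infinity>m. f (k * m + r))"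
proof -
  have bij: "bij_betw (\<lambda>(r, m). k * m + r) ({0..<k} \<times> UNIV) UNIV"
    by (rule bij_betw_byWitness[where f' = "\<lambda>n. (n mod k, n div k)"]) (use k in auto)
  have "infsum f UNIV = (\<Sum>\<^sub>\<infinity>(r, m)\<in>{0..<k} \<times> UNIV. f (k * m + r))"
    using infsum_reindex_bij_betw[OF bij, of f] by (simp add: case_prod_unfold)
  also have "\<dots> = (\<Sum>\<^sub>\<infinity>r\<in>{0..<k}. \<Sum>\<^sub>\<infinity>m. f (k * m + r))"
  proof (rule infsum_Sigma'_banach[symmetric])
    show "(\<lambda>(r, m). f (k * m + r)) summable_on {0..<k} \<times> UNIV"
      using summable_on_reindex_bij_betw[OF bij, of f] f by (simp add: case_prod_unfold)
  qed
  also have "\<dots> = (\<Sum>r\<in>{0..<k}. \<Sum>\<^sub>\<infinity>m. f (k * m + r))"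
    by simp
  finally show ?thesis .
qed

lemma infsum_minus_reindex: "(\<Sum>\<^sub>\<infinity>m::int. f (- m)) = (\<Sum>\<^sub>\<infinity>m. f m :: complex)"
  by (rule infsum_reindex_bij_betw) (auto intro!: bij_betwI[where g = uminus])

text \<open>Splitting (p; p)_infinity modulo 3, two classes form the theta function and the third is
  the Euler product of \<open>p^3\<close>.\<close>

lemma qpoch_inf_trisection:
  assumes p: "norm p < 1" "p \<noteq> 0"
  shows "qpoch_inf (p^3) (p^3) * theta p (p^3) = qpoch_inf p p"
proof -
  have e: "p ^ 3 / p = p^2" "p * p^1 = p^2" "p * p^2 = p^3" "p * p^0 = p"
    using p by (simp_all add: field_simps eval_nat_numeral)
  have "(\<Prod>i<3. f i) = f 0 * f 1 * f 2" for f :: "nat \<Rightarrow> complex"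
    by (simp add: numeral_3_eq_3 numeral_2_eq_2)
  then have "qpoch_inf p p = qpoch_inf p (p^3) * qpoch_inf (p^2) (p^3) * qpoch_inf (p^3) (p^3)"
    using qpoch_inf_multisection[OF p(1), of 3 p] by (simp only: e)
  then show ?thesis
    by (simp add: theta_def e)
qed

text \<open>Two triple-product series are multiplied and summed along \<open>n = i + 2 * j\<close>,
  the total power of \<open>z\<close>. For fixed \<open>n\<close> the sum over \<open>j\<close> is
  again a triple product, of base \<open>p^6\<close>, and its value depends essentially on
  \<open>n\<close> modulo 3: one class vanishes, the other two give the two series.\<close>

theorem quintuple_product:
  assumes p: "norm p < 1" "p \<noteq> 0" and z: "z \<noteq> 0"
  shows "qpoch_inf p p * theta z p * theta (p * z^2) (p^2) =
     (\<Sum>\<^sub>\<infinity>m. z powi (3 * m) * p powi (3 * tri m + m))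
   - (\<Sum>\<^sub>\<infinity>m. z powi (3 * m + 1) * p powi (3 * tri m + 2 * m))"
proof -
  let ?f = "\<lambda>(i, j). theta_term z p i * theta_term (p * z^2) (p^2) j"
  let ?F = "\<lambda>(n, j). theta_term z p n * theta_term (p powi (4 - 2 * n)) (p^6) j"
  let ?S = "(qpoch_inf p p * theta z p) * (qpoch_inf (p^2) (p^2) * theta (p * z^2) (p^2))"
  define E where "E = qpoch_inf (p^2) (p^2)"
  define G where "G = (\<lambda>n. theta_term z p n * (qpoch_inf (p^6) (p^6) * theta (p powi (4 - 2 * n)) (p^6)))"
  have p2: "norm (p^2) < 1" "p^2 \<noteq> 0" and p6: "norm (p^6) < 1" "p^6 \<noteq> 0"
    using p by (auto simp: norm_power power_less_one_iff)
  have E0: "E \<noteq> 0"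
    unfolding E_def by (rule qpoch_inf_nonzero[OF p2(1) p2(1)])
  have six: "(p^6) powi n = p powi (6 * n)" for n
    using power_int_mult[of p 6 n] by simp
  have eq: "?F (n, j) = ?f (n - 2 * j, j)" for n j
  proof -
    have t: "tri (n - 2 * j) + (j + 2 * tri j) = tri n + ((4 - 2 * n) * j + 6 * tri j)"
    proof -
      have "2 * (tri (n - 2 * j) + (j + 2 * tri j)) = 2 * (tri n + ((4 - 2 * n) * j + 6 * tri j))"
        unfolding distrib_left mult.left_commute[of 2] two_tri by (simp add: algebra_simps)
      then show ?thesis by simp
    qed
    have s: "(-1::complex) powi (n - 2 * j + j) = (-1) powi (n - 2 * j) * (-1) powi j"
      "z powi (n - 2 * j + 2 * j) = z powi (n - 2 * j) * z powi (2 * j)"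
      "p powi (tri (n - 2 * j) + (j + 2 * tri j)) = p powi (tri (n - 2 * j)) * (p powi j * p powi (2 * tri j))"
      by (rule power_int_add; use z in simp)+
        (use p(2) in \<open>simp only: power_int_add simp_thms\<close>)
    have "?f (n - 2 * j, j) = (-1) powi (n - 2 * j + j) * z powi (n - 2 * j + 2 * j)
        * p powi (tri (n - 2 * j) + (j + 2 * tri j))"
      unfolding prod.case theta_term_def power_int_mult_distrib power_int_square s by (simp only: mult_ac)
    also have "(-1::complex) powi (n - 2 * j + j) = (-1) powi n * (-1) powi j"
      unfolding s(1) by (simp add: power_int_diff minus_one_powi_double)
    also have "(-1) powi n * (-1) powi j * z powi (n - 2 * j + 2 * j) * p powi (tri (n - 2 * j) + (j + 2 * tri j))
       = ?F (n, j)"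
    proof -
      have "p powi (tri n + ((4 - 2 * n) * j + 6 * tri j))
          = p powi tri n * ((p powi (4 - 2 * n)) powi j * p powi (6 * tri j))"
        using p(2) by (simp only: power_int_add power_int_mult simp_thms)
      then show ?thesis
        unfolding t by (simp add: theta_term_def six)
    qed
    finally show ?thesis ..
  qed
  have bij: "bij_betw (\<lambda>(n, j). (n - 2 * j, j)) UNIV (UNIV :: (int \<times> int) set)"
    by (rule bij_betw_byWitness[where f' = "\<lambda>(i, j). (i + 2 * j, j)"]) auto
  have "(?f has_sum ?S) UNIV"
    using theta_terms_has_sum[of p z "p^2" "p * z^2"] p z p2 by simp
  then have "(?F has_sum ?S) (UNIV \<times> UNIV)"
    using has_sum_reindex_bij_betw[OF bij, of ?f ?S] by (simp add: eq[unfolded prod.case] case_prod_unfold)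
  then have G: "(G has_sum ?S) UNIV"
  proof (rule has_sum_Sigma')
    show "((\<lambda>j. ?F (n, j)) has_sum G n) UNIV" for n
      unfolding prod.case G_def using p
      by (intro has_sum_cmult_right jacobi_triple_product p6) auto
  qed
  have th: "theta (p powi (6 * m) * x) (p^6) = (-1) powi m * x powi (- m) * p powi (- 6 * tri m) * theta x (p^6)"
    if "x \<noteq> 0" for m x
    using theta_mult_base_powi[OF p6(1) that p6(2), of m] by (simp add: six)
  have four: "theta (p^4) (p^6) = theta (p^2) (p^6)"
  proof -
    have "p ^ 6 / p^2 = p^4"
      using p by (simp add: field_simps flip: power_add)
    then show ?thesis
      using theta_reflect[OF p6(2) p2(2)] by simp
  qed
  have one: "theta 1 (p^6) = 0"
    using qpoch_inf_rec[OF p6(1), of 1] by (simp add: theta_def)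
  have sgn: "(-1) powi (3 * m) * (-1) powi (- m) = (1 :: complex)" for m
    using minus_one_powi_double[of m] by (simp flip: power_int_add)
  have t3: "tri (3 * m) = 9 * tri m + 3 * m" for m
  proof -
    have "2 * tri (3 * m) = 2 * (9 * tri m + 3 * m)"
      using two_tri[of "3 * m"] two_tri[of m] by (simp add: algebra_simps)
    then show ?thesis by simp
  qed
  \<comment> \<open>Trisection at base \<open>p^2\<close> shows that both surviving classes carry
    the Euler product \<open>E\<close>, which also stands on the left and cancels.\<close>
  have E: "qpoch_inf (p^6) (p^6) * theta (p^2) (p^6) = E"
    using qpoch_inf_trisection[OF p2] by (simp add: E_def flip: power_mult)
  have G0: "G (3 * m) = E * (z powi (3 * m) * p powi (3 * tri m + m))" for m
  proof -
    have "p powi (4 - 2 * (3 * m)) = p powi (6 * - m) * p ^ 4"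
      using power_int_add[of p "6 * - m" 4] p by (simp add: add.commute)
    then have "theta (p powi (4 - 2 * (3 * m))) (p^6)
       = (-1) powi (- m) * p powi (4 * m + - 6 * tri (- m)) * theta (p^2) (p^6)"
      using th[of "p^4" "- m"] p power_int_mult[of p 4 m]
      by (simp add: four power_int_diff power_int_minus field_simps)
    then have "G (3 * m) = ((-1) powi (3 * m) * (-1) powi (- m)) * z powi (3 * m)
       * (p powi (9 * tri m + 3 * m) * p powi (4 * m + - 6 * tri (- m)))
       * (qpoch_inf (p^6) (p^6) * theta (p^2) (p^6))"
      unfolding G_def theta_term_def t3 by (simp add: mult_ac)
    also have "p powi (9 * tri m + 3 * m) * p powi (4 * m + - 6 * tri (- m)) = p powi (3 * tri m + m)"
      using p by (simp add: tri_minus add.commute flip: power_int_add)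
    finally show ?thesis
      by (simp add: sgn E)
  qed
  have G1: "G (3 * m + 1) = - E * (z powi (3 * m + 1) * p powi (3 * tri m + 2 * m))" for m
  proof -
    have t: "tri (3 * m + 1) = 9 * tri m + 6 * m"
      using tri_add[of "3 * m" 1] by (simp add: t3 tri_def[of 1])
    have "p powi (4 - 2 * (3 * m + 1)) = p powi (6 * - m) * p ^ 2"
      using power_int_add[of p "6 * - m" 2] p by (simp add: add.commute)
    then have "theta (p powi (4 - 2 * (3 * m + 1))) (p^6)
       = (-1) powi (- m) * p powi (2 * m + - 6 * tri (- m)) * theta (p^2) (p^6)"
      using th[of "p^2" "- m"] p power_int_mult[of p 2 m]
      by (simp add: power_int_diff power_int_minus field_simps)
    then have "G (3 * m + 1) = - ((-1) powi (3 * m) * (-1) powi (- m)) * z powi (3 * m + 1)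
       * (p powi (9 * tri m + 6 * m) * p powi (2 * m + - 6 * tri (- m)))
       * (qpoch_inf (p^6) (p^6) * theta (p^2) (p^6))"
      unfolding G_def theta_term_def t by (simp add: power_int_add[of "-1"] mult_ac)
    also have "p powi (9 * tri m + 6 * m) * p powi (2 * m + - 6 * tri (- m)) = p powi (3 * tri m + 2 * m)"
      using p by (simp add: tri_minus add.commute flip: power_int_add)
    finally show ?thesis
      by (simp add: sgn E)
  qed
  \<comment> \<open>The theta argument is a power of the base \<open>p^6\<close>, where theta
    vanishes.\<close>
  have G2: "G (3 * m + 2) = 0" for m
    using th[of 1 "- m"] p by (simp add: G_def one)
  have "?S = infsum G UNIV"
    using G by (simp add: infsumI)
  also have "\<dots> = (\<Sum>r\<in>{0..<3}. \<Sum>\<^sub>\<infinity>m. G (3 * m + r))"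
    using G by (intro infsum_residue_classes) (auto simp: summable_on_def)
  also have "{0..<3} = {0, 1, 2 :: int}" by auto
  also have "(\<Sum>r\<in>{0, 1, 2}. \<Sum>\<^sub>\<infinity>m. G (3 * m + r))
      = E * ((\<Sum>\<^sub>\<infinity>m. z powi (3 * m) * p powi (3 * tri m + m))
         - (\<Sum>\<^sub>\<infinity>m. z powi (3 * m + 1) * p powi (3 * tri m + 2 * m)))"
    by (simp add: G0 G1 G2 infsum_cmult_right' infsum_uminus right_diff_distrib)
  finally have "E * (qpoch_inf p p * theta z p * theta (p * z^2) (p^2)) = \<dots>"
    by (simp add: E_def mult_ac)
  then show ?thesis
    using E0 by simp
qed

text \<open>This identifies the product in \<open>quintuple_product\<close> with the quotient of
  \<open>theta (z^2) p\<close> by \<open>theta (- z) p\<close>.\<close>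

lemma theta_quintuple_quotient:
  assumes "norm p < 1" "p \<noteq> 0" "z \<noteq> 0"
  shows "theta z p * theta (p * z^2) (p^2) * theta (- z) p = theta (z^2) p"
  using theta_mult_minus[OF assms(1), of z] theta_bisection[OF assms(1) _ assms(2), of "z^2"] assms
  by (simp add: mult_ac)

lemma theta_nonzero:
  assumes "norm p < 1" "norm x < 1" "norm (p / x) < 1"
  shows "theta x p \<noteq> 0"
  using assms by (simp add: theta_def qpoch_inf_nonzero)

text \<open>Euler's pentagonal number theorem: the triple product of base \<open>q^3\<close> at
  \<open>q\<close>, combined with trisection. The exponent is
  \<open>n * (3 * n - 1) / 2\<close>.\<close>

lemma pentagonal_has_sum:
  assumes q: "norm q < 1" "q \<noteq> 0"
  shows "((\<lambda>n. (-1) powi n * q powi (n + 3 * tri n)) has_sum qpoch_inf q q) UNIV"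
proof -
  have q3: "norm (q^3) < 1" "q^3 \<noteq> 0"
    using q by (auto simp: norm_power power_less_one_iff)
  have "theta_term q (q^3) = (\<lambda>n. (-1) powi n * q powi (n + 3 * tri n))"
    using q power_int_mult[of q 3] by (auto simp: fun_eq_iff theta_term_def power_int_add)
  then show ?thesis
    using jacobi_triple_product[OF q3 q(2)] by (simp add: qpoch_inf_trisection[OF q])
qed

text \<open>The pentagonal series is sorted by \<open>n\<close> modulo 5. The classes 0 and 2 form a
  quintuple product at \<open>- Q\<close>, the classes 3 and 4 one at \<open>- (Q^2)\<close>, and
  class 1 is again a pentagonal series, now in \<open>P\<close>.\<close>

lemma euler_dissection:
  assumes q: "norm q < 1" "q \<noteq> 0"
  defines "Q \<equiv> q ^ 5" and "P \<equiv> q ^ 25"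
  shows "qpoch_inf q q = qpoch_inf P P *
    (theta (- Q) P * theta (P * Q^2) (P^2) - q - q^2 * (theta (- (Q^2)) P * theta (P * Q^4) (P^2)))"
proof -
  define g where "g = (\<lambda>n. (-1) powi n * q powi (n + 3 * tri n))"
  have P: "norm P < 1" "P \<noteq> 0" and Q: "Q \<noteq> 0"
    using q by (auto simp: P_def Q_def norm_power power_less_one_iff)
  have pw: "Q powi n = q powi (5 * n)" "(Q^2) powi n = q powi (10 * n)" "P powi n = q powi (25 * n)" for n
    using power_int_mult[of q 5 n] power_int_mult[of q 10 n] power_int_mult[of q 25 n]
    by (simp_all add: P_def Q_def flip: power_mult)
  have m: "(- Q) powi n = (-1) powi n * Q powi n" "(- (Q^2)) powi n = (-1) powi n * (Q^2) powi n" for n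
    using power_int_mult_distrib[of "-1" Q n] power_int_mult_distrib[of "-1" "Q^2" n] by simp_all
  have s: "(-1) powi (3 * m) = ((-1) powi m :: complex)" "(-1) powi (3 * m + 1) = (- ((-1) powi m) :: complex)"
    "(-1) powi (5 * m) = ((-1) powi m :: complex)" "(-1) powi (5 * m + 1) = (- ((-1) powi m) :: complex)"
    "(-1) powi (5 * m + 2) = ((-1) powi m :: complex)" "(-1) powi (5 * m + 3) = (- ((-1) powi m) :: complex)"
    "(-1) powi (- m) = ((-1) powi m :: complex)" for m :: int
    by (simp_all add: power_int_minus_left)
  have t5: "tri (5 * m) = 25 * tri m + 10 * m" for m
  proof -
    have "2 * tri (5 * m) = 2 * (25 * tri m + 10 * m)"
      using two_tri[of "5 * m"] two_tri[of m] by (simp add: algebra_simps)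
    then show ?thesis by simp
  qed
  have tv: "tri 1 = 0" "tri 2 = 1" "tri 3 = 3" by (simp_all add: tri_def)
  have ex: "q powi (a + b) = q powi a * q powi b" for a b
    using q by (simp add: power_int_add)
  have e: "q powi (1 + b) = q * q powi b" "q powi (2 + b) = q^2 * q powi b" "q powi (12 + b) = q^2 * q powi (10 + b)" for b
    using ex[of 1 b] ex[of 2 b] ex[of 2 "10 + b"] by simp_all
  \<comment> \<open>The class is traversed with \<open>- m\<close> so that the exponents agree with
    those of \<open>quintuple_product\<close>; the same holds for \<open>r4\<close>.\<close>
  have r0: "g (- (5 * m)) = (- Q) powi (3 * m) * P powi (3 * tri m + m)" for m
    unfolding g_def m pw s mult.assoc ex[symmetric] tri_minus tri_add t5 tv by (simp add: algebra_simps)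
  have r2: "g (5 * m + 2) = - ((- Q) powi (3 * m + 1) * P powi (3 * tri m + 2 * m))" for m
    unfolding g_def m pw s mult.assoc ex[symmetric] tri_minus tri_add t5 tv by (simp add: algebra_simps)
  have r3: "g (5 * m + 3) = q^2 * ((- (Q^2)) powi (3 * m + 1) * P powi (3 * tri m + 2 * m))" for m
    unfolding g_def m pw s mult.assoc ex[symmetric] tri_minus tri_add t5 tv by (simp add: algebra_simps e)
  have r4: "g (- (5 * m + 1)) = - (q^2) * ((- (Q^2)) powi (3 * m) * P powi (3 * tri m + m))" for m
    unfolding g_def m pw s mult.assoc ex[symmetric] tri_minus tri_add t5 tv by (simp add: algebra_simps e)
  have r1: "g (5 * m + 1) = - q * ((-1) powi (- m) * P powi (- m + 3 * tri (- m)))" for m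
    unfolding g_def pw s mult.assoc ex[symmetric] tri_minus tri_add t5 tv by (simp add: algebra_simps e)
  have X: "qpoch_inf P P * (theta (- Q) P * theta (P * Q^2) (P^2) - q
          - q^2 * (theta (- (Q^2)) P * theta (P * Q^4) (P^2)))
      = (\<Sum>\<^sub>\<infinity>m. (- Q) powi (3 * m) * P powi (3 * tri m + m))
      - (\<Sum>\<^sub>\<infinity>m. (- Q) powi (3 * m + 1) * P powi (3 * tri m + 2 * m)) - q * qpoch_inf P P
      - q^2 * ((\<Sum>\<^sub>\<infinity>m. (- (Q^2)) powi (3 * m) * P powi (3 * tri m + m))
             - (\<Sum>\<^sub>\<infinity>m. (- (Q^2)) powi (3 * m + 1) * P powi (3 * tri m + 2 * m)))"
    using Q by (subst (1 2) quintuple_product[OF P, symmetric]) (simp_all add: algebra_simps)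
  have g: "(g has_sum qpoch_inf q q) UNIV"
    unfolding g_def by (rule pentagonal_has_sum[OF q])
  have "qpoch_inf q q = infsum g UNIV"
    using g by (simp add: infsumI)
  also have "\<dots> = (\<Sum>r\<in>{0..<5}. \<Sum>\<^sub>\<infinity>m. g (5 * m + r))"
    using g by (intro infsum_residue_classes) (auto simp: summable_on_def)
  also have "{0..<5} = {0, 1, 2, 3, 4 :: int}" by auto
  also have "(\<Sum>r\<in>{0, 1, 2, 3, 4}. \<Sum>\<^sub>\<infinity>m. g (5 * m + r))
     = (\<Sum>\<^sub>\<infinity>m. g (5 * m)) + (\<Sum>\<^sub>\<infinity>m. g (5 * m + 1)) + (\<Sum>\<^sub>\<infinity>m. g (5 * m + 2))
       + (\<Sum>\<^sub>\<infinity>m. g (5 * m + 3)) + (\<Sum>\<^sub>\<infinity>m. g (5 * m + 4))"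
    by simp
  also have "(\<Sum>\<^sub>\<infinity>m. g (5 * m)) = (\<Sum>\<^sub>\<infinity>m. (- Q) powi (3 * m) * P powi (3 * tri m + m))"
    using infsum_minus_reindex[of "\<lambda>m. g (5 * m)"] by (simp add: r0)
  also have "(\<Sum>\<^sub>\<infinity>m. g (5 * m + 1)) = - q * qpoch_inf P P"
    using infsum_minus_reindex[of "\<lambda>m. (-1) powi m * P powi (m + 3 * tri m)"]
      infsumI[OF pentagonal_has_sum[OF P]] by (simp add: r1 infsum_cmult_right' infsum_uminus)
  also have "(\<Sum>\<^sub>\<infinity>m. g (5 * m + 2)) = - (\<Sum>\<^sub>\<infinity>m. (- Q) powi (3 * m + 1) * P powi (3 * tri m + 2 * m))"
    by (simp add: r2 infsum_uminus)
  also have "(\<Sum>\<^sub>\<infinity>m. g (5 * m + 3)) = q^2 * (\<Sum>\<^sub>\<infinity>m. (- (Q^2)) powi (3 * m + 1) * P powi (3 * tri m + 2 * m))"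
    by (simp add: r3 infsum_cmult_right')
  \<comment> \<open>The index \<open>- (5 * m + 1)\<close> also runs through class 4, by
    \<open>m\<close> to \<open>- m - 1\<close>.\<close>
  also have "(\<Sum>\<^sub>\<infinity>m. g (5 * m + 4)) = (\<Sum>\<^sub>\<infinity>m. g (- (5 * m + 1)))"
  proof -
    have "bij_betw (\<lambda>m. - m - 1) UNIV (UNIV :: int set)"
      by (rule bij_betwI[where g = "\<lambda>m. - m - 1"]) auto
    from infsum_reindex_bij_betw[OF this, of "\<lambda>m. g (- (5 * m + 1))"] show ?thesis
      by (simp add: algebra_simps)
  qed
  also have "\<dots> = - (q^2) * (\<Sum>\<^sub>\<infinity>m. (- (Q^2)) powi (3 * m) * P powi (3 * tri m + m))"
    by (simp only: r4 infsum_cmult_right')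
  finally show ?thesis
    unfolding X by (simp add: right_diff_distrib)
qed

lemma RR_eq_theta:
  assumes "q \<noteq> 0"
  shows "RR q = theta q (q^5) / theta (q^2) (q^5)"
proof -
  have "q^5 / q = q^4" "q^5 / q^2 = q^3"
    using assms by (simp_all add: field_simps eval_nat_numeral)
  then show ?thesis
    by (simp add: RR_def qpochs_inf_def theta_def)
qed

section \<open>Relations at level ten\<close>

text \<open>By \<open>t10_reflect\<close> only the indices 1 to 5 are essential; these five values
  generate all quantities at level ten.\<close>

definition t10 :: "complex \<Rightarrow> nat \<Rightarrow> complex" where
  "t10 q n = theta (q ^ n) (q ^ 10)"

lemma power_div_power_le: "q \<noteq> 0 \<Longrightarrow> n \<le> m \<Longrightarrow> q ^ m / q ^ n = (q ^ (m - n) :: complex)"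
  by (simp add: power_diff)

lemma t10_nonzero:
  assumes "norm q < 1" "q \<noteq> 0" "0 < n" "n < 10"
  shows "t10 q n \<noteq> 0"
  unfolding t10_def using assms
  by (intro theta_nonzero) (auto simp: power_div_power_le norm_power power_less_one_iff)

lemma t10_reflect: "q \<noteq> 0 \<Longrightarrow> n \<le> 10 \<Longrightarrow> t10 q (10 - n) = t10 q n"
  using theta_reflect[of "q ^ 10" "q ^ n"] by (simp add: t10_def power_div_power_le)

lemma t10_shift:
  assumes "norm q < 1" "q \<noteq> 0"
  shows "theta (q ^ (10 + n)) (q ^ 10) = - t10 q n / q ^ n"
  using theta_mult_base[of "q ^ 10" "q ^ n"] assms
  by (simp add: t10_def power_add norm_power power_less_one_iff)

lemma t10_inverse:
  assumes "norm q < 1" "q \<noteq> 0"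
  shows "theta (1 / q ^ n) (q ^ 10) = - t10 q n / q ^ n"
  using theta_inverse[of "q ^ 10" "q ^ n"] assms
  by (simp add: t10_def norm_power power_less_one_iff)

text \<open>After division by the first term on the left this evaluates \<open>1 - K\<close> in
  \<open>level_ten_relations\<close>.\<close>

lemma t10_three_term_1:
  assumes q: "norm q < 1" "q \<noteq> 0"
  shows "t10 q 2 * (t10 q 3)^2 * t10 q 4 - q * t10 q 1 * (t10 q 2)^2 * t10 q 3
       = t10 q 5 * t10 q 1 * (t10 q 4)^2"
proof -
  have p: "norm (q^10) < 1" "q^10 \<noteq> 0"
    using q by (auto simp: norm_power power_less_one_iff)
  have pw: "q^3 = q*q*q" "q^4 = q*q*q*q" "q^5 = q*q*q*q*q" "q^7 = q*q*q*q*q*q*q"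
    by (simp_all add: eval_nat_numeral)
  have e: "q^8 * q^6 = q^(10+4)" "q^8 / q^6 = q^2" "q^3 * q^6 = q^9" "q^3 / q^6 = 1 / q^3"
    "q^8 * q^3 = q^(10+1)" "q^8 / q^3 = q^5"
    using q by (simp_all add: field_simps eval_nat_numeral)
  have r: "theta (q^9) (q^10) = t10 q 1" "theta (q^8) (q^10) = t10 q 2" "theta (q^6) (q^10) = t10 q 4"
    using t10_reflect[OF q(2), of 1] t10_reflect[OF q(2), of 2] t10_reflect[OF q(2), of 4]
    by (simp_all add: t10_def)
  have "- t10 q 4 / q^4 * t10 q 2 * (t10 q 3 * t10 q 3) - t10 q 2 * t10 q 2 * (t10 q 1 * (- t10 q 3 / q^3))
     = 1 / q^3 * (t10 q 4 * t10 q 4 * (- t10 q 1 / q * t10 q 5))"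
    using theta_three_term[OF p, of "q^8" "q^6" "q^3" 1] q
    unfolding e t10_shift[OF q] t10_inverse[OF q] r by (simp add: t10_def r[unfolded t10_def])
  then have "q^4 * (t10 q 2 * (t10 q 3)^2 * t10 q 4 - q * t10 q 1 * (t10 q 2)^2 * t10 q 3)
      = q^4 * (t10 q 5 * t10 q 1 * (t10 q 4)^2)"
    using q(2) by (simp add: field_simps power2_eq_square pw)
  then show ?thesis
    using q(2) by simp
qed

text \<open>The companion of the preceding relation, for \<open>1 + K\<close>.\<close>

lemma t10_three_term_2:
  assumes q: "norm q < 1" "q \<noteq> 0"
  shows "t10 q 1 * t10 q 3 * (t10 q 4)^2 + q * (t10 q 1)^2 * t10 q 2 * t10 q 4
       = t10 q 5 * (t10 q 2)^2 * t10 q 3"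
proof -
  have p: "norm (q^10) < 1" "q^10 \<noteq> 0"
    using q by (auto simp: norm_power power_less_one_iff)
  have pw: "q^3 = q*q*q" "q^4 = q*q*q*q" "q^5 = q*q*q*q*q" "q^7 = q*q*q*q*q*q*q"
    by (simp_all add: eval_nat_numeral)
  have e: "q^2 * q^1 = q^3" "q^2 / q^1 = q^1" "q^4 * q^1 = q^5" "q^4 / q^1 = q^3"
    "q^2 * q^4 = q^6" "q^2 / q^4 = 1 / q^2"
    using q by (simp_all add: field_simps eval_nat_numeral)
  have r: "theta (q^6) (q^10) = t10 q 4"
    using t10_reflect[OF q(2), of 4] by (simp add: t10_def)
  have "t10 q 3 * t10 q 1 * (t10 q 4 * t10 q 4) - t10 q 2 * t10 q 2 * (t10 q 5 * t10 q 3)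
     = q^3 * (t10 q 1 * t10 q 1 * (t10 q 4 * (- t10 q 2 / q^2)))"
    using theta_three_term[OF p, of "q^2" "q^1" "q^4" 1] q
    unfolding e t10_inverse[OF q] r by (simp add: t10_def r[unfolded t10_def])
  then show ?thesis
    using q(2) by (simp add: field_simps power2_eq_square pw)
qed

text \<open>It turns the sum of \<open>(t10 q 5)^2\<close> and \<open>q * t10 q 1 * t10 q 3\<close>
  into a monomial, as needed for \<open>1 + K - K^2\<close>.\<close>

lemma t10_three_term_3:
  assumes q: "norm q < 1" "q \<noteq> 0"
  shows "(t10 q 2)^2 * (t10 q 4)^2 = q * (t10 q 1)^2 * (t10 q 3)^2 + (t10 q 5)^2 * t10 q 1 * t10 q 3"
proof -
  have p: "norm (q^10) < 1" "q^10 \<noteq> 0"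
    using q by (auto simp: norm_power power_less_one_iff)
  have pw: "q^3 = q*q*q" "q^4 = q*q*q*q" "q^5 = q*q*q*q*q" "q^7 = q*q*q*q*q*q*q"
    by (simp_all add: eval_nat_numeral)
  have e: "q^3 * q^1 = q^4" "q^3 / q^1 = q^2" "q^8 * q^6 = q^(10+4)" "q^8 / q^6 = q^2"
    "q^3 * q^6 = q^9" "q^3 / q^6 = 1 / q^3" "q^8 * q^1 = q^9" "q^8 / q^1 = q^7"
    "q^1 * q^6 = q^7" "q^1 / q^6 = 1 / q^5" "q^3 * q^8 = q^(10+1)" "q^3 / q^8 = 1 / q^5"
    using q by (simp_all add: field_simps eval_nat_numeral)
  have r: "theta (q^9) (q^10) = t10 q 1" "theta (q^7) (q^10) = t10 q 3"
    using t10_reflect[OF q(2), of 1] t10_reflect[OF q(2), of 3] by (simp_all add: t10_def)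
  have "t10 q 4 * t10 q 2 * (- t10 q 4 / q^4 * t10 q 2) - t10 q 1 * (- t10 q 3 / q^3) * (t10 q 1 * t10 q 3)
     = q^7 * (t10 q 3 * (- t10 q 5 / q^5) * (- t10 q 1 / q^1 * (- t10 q 5 / q^5)))"
    using theta_three_term[OF p, of "q^3" "q^1" "q^8" "q^6"] q
    unfolding e t10_shift[OF q] t10_inverse[OF q] r by (simp add: t10_def r[unfolded t10_def])
  then have "q^4 * ((t10 q 2)^2 * (t10 q 4)^2)
      = q^4 * (q * (t10 q 1)^2 * (t10 q 3)^2 + (t10 q 5)^2 * t10 q 1 * t10 q 3)"
    using q(2) by (simp add: field_simps power2_eq_square pw)
  then show ?thesis
    using q(2) by simp
qed

text \<open>The negative arguments bring in \<open>theta (-1) (q^5)\<close>, whose factor 2 is the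
  source of the 4 in \<open>1 - 4 * K - K^2\<close>.\<close>

lemma theta_signed_three_term:
  assumes q: "norm q < 1" "q \<noteq> 0"
  shows "(theta q (q^5))^2 * (theta (q^2) (q^5))^2 = (theta (- q) (q^5))^2 * (theta (- (q^2)) (q^5))^2
    - q * (theta (-1) (q^5))^2 * (theta (- q) (q^5) * theta (- (q^2)) (q^5))"
proof -
  have p: "norm (q^5) < 1" "q^5 \<noteq> 0"
    using q by (auto simp: norm_power power_less_one_iff)
  have e: "q / - (q^2) = 1 / (- q)" "q * - (q^2) = - (q^3)" "q^5 / (- (q^2)) = - (q^3)"
    using q by (simp_all add: field_simps eval_nat_numeral)
  have "theta (- (q^3)) (q^5) = theta (- (q^2)) (q^5)"
    using theta_reflect[OF p(2), of "- (q^2)"] q unfolding e by simp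
  moreover have "theta (1 / - q) (q^5) = theta (- q) (q^5) / q"
    using theta_inverse[OF p(1), of "- q"] q by simp
  ultimately have "theta q (q^5) * theta q (q^5) * (theta (q^2) (q^5) * theta (q^2) (q^5))
     - theta (- q) (q^5) * theta (- q) (q^5) * (theta (- (q^2)) (q^5) * theta (- (q^2)) (q^5))
     = - (q^2) * (theta (-1) (q^5) * theta (-1) (q^5) * (theta (- (q^2)) (q^5) * (theta (- q) (q^5) / q)))"
    using theta_three_term[OF p, of q 1 "- (q^2)" "-1"] q unfolding e by simp
  then show ?thesis
    using q(2) by (simp add: field_simps power2_eq_square)
qed

text \<open>Bisection gives the unsigned values and \<open>theta_mult_minus\<close> the signed ones,
  so base \<open>q^5\<close> is reduced to monomials at base \<open>q^10\<close>.\<close>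

lemma theta5_eq_t10:
  assumes q: "norm q < 1" "q \<noteq> 0"
  shows "theta q (q^5) = t10 q 1 * t10 q 4" (is ?T1)
    and "theta (q^2) (q^5) = t10 q 2 * t10 q 3" (is ?T2)
    and "theta (- q) (q^5) = t10 q 2 / (t10 q 1 * t10 q 4)" (is ?S1)
    and "theta (- (q^2)) (q^5) = t10 q 4 / (t10 q 2 * t10 q 3)" (is ?S2)
proof -
  have p: "norm (q^5) < 1" "q^5 \<noteq> 0"
    using q by (auto simp: norm_power power_less_one_iff)
  have e: "(q^5)^2 = q^10" "q^5 * q = q^6" "q^5 * q^2 = q^7" "(q^2)^2 = q^4"
    by (simp_all add: eval_nat_numeral)
  have r: "theta (q^6) (q^10) = t10 q 4" "theta (q^7) (q^10) = t10 q 3"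
    using t10_reflect[OF q(2), of 4] t10_reflect[OF q(2), of 3] by (simp_all add: t10_def)
  show T1: ?T1 and T2: ?T2
    using theta_bisection[OF p(1) _ p(2), of q] theta_bisection[OF p(1) _ p(2), of "q^2"] q
    unfolding e r by (simp_all add: t10_def)
  have nz: "t10 q n \<noteq> 0" if "n \<in> {1, 2, 3, 4}" for n
    using t10_nonzero[OF q] that by auto
  have "theta q (q^5) * theta (- q) (q^5) = t10 q 2"
    using theta_mult_minus[OF p(1), of q] by (simp add: e t10_def)
  then show ?S1
    unfolding T1 using nz[of 1] nz[of 4] by (simp add: field_simps)
  have "theta (q^2) (q^5) * theta (- (q^2)) (q^5) = t10 q 4"
    using theta_mult_minus[OF p(1), of "q^2"] by (simp add: e t10_def)
  then show ?S2
    unfolding T2 using nz[of 2] nz[of 3] by (simp add: field_simps)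
qed

lemma qpoch_inf_minus_self_t10:
  assumes q: "norm q < 1" "q \<noteq> 0"
  shows "(qpoch_inf (- (q^5)) (q^5))^2 = 1 / t10 q 5" (is ?M5)
    and "theta (-1) (q^5) = 2 / t10 q 5"
    and "qpoch_inf (- q) q = qpoch_inf (- (q^5)) (q^5) / (t10 q 1 * t10 q 3)"
proof -
  let ?p = "q^5" and ?M = "qpoch_inf (- (q^5)) (q^5)"
  have p: "norm ?p < 1" "?p \<noteq> 0" and p2: "norm (?p^2) < 1"
    using q by (auto simp: norm_power power_less_one_iff)
  have e: "?p^2 = q^10"
    by (simp add: eval_nat_numeral)
  have nz: "t10 q n \<noteq> 0" if "n \<in> {1, 2, 3, 4, 5}" for n
    using t10_nonzero[OF q] that by auto
  have "qpoch_inf ?p ?p \<noteq> 0" "qpoch_inf (?p^2) (?p^2) \<noteq> 0"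
    using qpoch_inf_nonzero[OF p(1) p(1)] qpoch_inf_nonzero[OF p2 p2] by auto
  moreover have "qpoch_inf ?p ?p * ?M = qpoch_inf (?p^2) (?p^2)"
    by (rule qpoch_inf_mult_minus[OF p(1)])
  moreover have "qpoch_inf ?p ?p = qpoch_inf ?p (?p^2) * qpoch_inf (?p^2) (?p^2)"
    using qpoch_inf_multisection[OF p(1), of 2 ?p] by (simp add: numeral_2_eq_2)
  \<comment> \<open>Euler's identity between partitions into odd and into distinct parts.\<close>
  ultimately have "qpoch_inf ?p (?p^2) * ?M = 1"
    by simp
  then have "(qpoch_inf ?p (?p^2) * ?M)^2 = 1" by simp
  moreover have "t10 q 5 = (qpoch_inf ?p (?p^2))^2"
    using power_div_power_le[OF q(2), of 5 10] unfolding t10_def theta_def e by (simp add: power2_eq_square)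
  ultimately show M: ?M5
    using nz[of 5] by (simp add: field_simps power_mult_distrib)
  have "theta (-1) ?p = (1 - (-1)) * qpoch_inf (- ?p) ?p * qpoch_inf (- ?p) ?p"
    unfolding theta_def by (subst qpoch_inf_rec[OF p(1), of "-1"]) simp
  then show "theta (-1) (q^5) = 2 / t10 q 5"
    using M by (simp add: power2_eq_square mult.assoc)
  have "(\<Prod>i<5. f i) = f 0 * f 1 * f 2 * f 3 * f 4" for f :: "nat \<Rightarrow> complex"
    by (simp add: eval_nat_numeral)
  moreover have "q * q^1 = q^2" "q * q^2 = q^3" "q * q^3 = q^4" "q * q^4 = q^5"
    by (simp_all add: eval_nat_numeral)
  \<comment> \<open>Multisection modulo 5 pairs four classes into two signed theta functions and
    leaves \<open>?M\<close>.\<close>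
  ultimately have "qpoch_inf (- q) q = qpoch_inf (- q) ?p * qpoch_inf (- (q^2)) ?p * qpoch_inf (- (q^3)) ?p 
       * qpoch_inf (- (q^4)) ?p * ?M"
    using qpoch_inf_multisection[OF q(1), of 5 "- q"] by simp
  also have "\<dots> = theta (- q) ?p * theta (- (q^2)) ?p * ?M"
    using power_div_power_le[OF q(2), of 1 5] power_div_power_le[OF q(2), of 2 5]
    by (simp add: theta_def)
  also have "\<dots> = ?M / (t10 q 1 * t10 q 3)"
    unfolding theta5_eq_t10[OF q] using nz by simp
  finally show "qpoch_inf (- q) q = ?M / (t10 q 1 * t10 q 3)" .
qed

lemma RR_t10:
  assumes q: "norm q < 1" "q \<noteq> 0"
  shows "RR q = t10 q 1 * t10 q 4 / (t10 q 2 * t10 q 3)" "RR (q^2) = t10 q 2 / t10 q 4"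
proof -
  show "RR q = t10 q 1 * t10 q 4 / (t10 q 2 * t10 q 3)"
    unfolding RR_eq_theta[OF q(2)] theta5_eq_t10[OF q] by simp
  have "(q^2)^5 = q^10" "(q^2)^2 = q^4"
    by (simp_all add: eval_nat_numeral)
  then show "RR (q^2) = t10 q 2 / t10 q 4"
    using RR_eq_theta[of "q^2"] q by (simp add: t10_def)
qed

text \<open>\<open>K\<close> is Ramanujan's parameter k. With w =
  \<open>q * t10 q 1 * t10 q 3 / (t10 q 5)^2\<close> one has K = (1 - K^2) w, so the last two
  expressions are 1 - K^2 times 1 - 4 w and 1 + w, and both of these are monomials.\<close>

lemma level_ten_relations:
  assumes q: "norm q < 1" "q \<noteq> 0"
  defines "K \<equiv> q * RR q * (RR (q^2))^2"
  shows "1 - K = t10 q 5 * t10 q 1 * t10 q 4 / (t10 q 2 * (t10 q 3)^2)" (is ?A)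
    and "1 + K = t10 q 5 * (t10 q 2)^2 / (t10 q 1 * (t10 q 4)^2)" (is ?B)
    and "1 - 4 * K - K^2 = (t10 q 5)^2 * (t10 q 1)^4 * (t10 q 2)^3 * (t10 q 3)^2 * t10 q 4" (is ?D)
    and "1 + K - K^2 = (t10 q 2)^3 * t10 q 4 / (t10 q 1 * (t10 q 3)^3)" (is ?C)
proof -
  define a b c d e where "a = t10 q 1" and "b = t10 q 2" and "c = t10 q 3" and "d = t10 q 4" and "e = t10 q 5"
  note defs = a_def[symmetric] b_def[symmetric] c_def[symmetric] d_def[symmetric] e_def[symmetric]
  have nz: "a \<noteq> 0" "b \<noteq> 0" "c \<noteq> 0" "d \<noteq> 0" "e \<noteq> 0"
    using t10_nonzero[OF q] by (auto simp: a_def b_def c_def d_def e_def)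
  have K: "K = q * a * b / (c * d)"
    unfolding K_def RR_t10[OF q] defs using nz by (simp add: field_simps power2_eq_square)
  have A': "1 - K = e * a * d / (b * c^2)"
    using nz unfolding K by (simp add: divide_simps) (use t10_three_term_1[OF q, unfolded defs] in algebra)
  then show ?A unfolding defs .
  have B': "1 + K = e * b^2 / (a * d^2)"
    using nz unfolding K by (simp add: divide_simps) (use t10_three_term_2[OF q, unfolded defs] in algebra)
  then show ?B unfolding defs .
  have AB: "1 - K^2 = e^2 * b / (c^2 * d)"
  proof -
    have "1 - K^2 = (1 - K) * (1 + K)" by (simp add: algebra_simps power2_eq_square)
    also have "\<dots> = e^2 * b / (c^2 * d)"
      unfolding A' B' using nz by (simp add: divide_simps) (simp add: power2_eq_square)
    finally show ?thesis .
  qed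
  have K': "K = (1 - K^2) * (q * a * c / e^2)"
    unfolding AB using nz by (simp add: K field_simps power2_eq_square)
  have "(a * d)^2 * (b * c)^2 = (b / (a * d))^2 * (d / (b * c))^2 - q * (2 / e)^2 * (b / (a * d) * (d / (b * c)))"
    using theta_signed_three_term[OF q]
    unfolding theta5_eq_t10[OF q] qpoch_inf_minus_self_t10(2)[OF q] defs .
  \<comment> \<open>The signed three-term relation is solved for 1 - 4 w.\<close>
  then have "a^4 * b^2 * c^4 * d^2 = 1 - 4 * (q * a * c / e^2)"
    using nz by (simp add: field_simps eval_nat_numeral)
  then have "(1 - K^2) * (a^4 * b^2 * c^4 * d^2) = (1 - K^2) - 4 * ((1 - K^2) * (q * a * c / e^2))"
    by (simp only: right_diff_distrib mult_1_right mult.left_commute[of 4])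
  then have "1 - 4 * K - K^2 = (1 - K^2) * (a^4 * b^2 * c^4 * d^2)"
    unfolding K'[symmetric] by simp
  also have "\<dots> = e^2 * a^4 * b^3 * c^2 * d"
    unfolding AB using nz by (simp add: field_simps eval_nat_numeral)
  finally show ?D unfolding defs .
  have "1 + K - K^2 = (1 - K^2) * (1 + q * a * c / e^2)"
    using K' by (simp add: algebra_simps)
  also have "\<dots> = b / (c^2 * d) * (e^2 + q * a * c)"
    unfolding AB using nz by (simp add: field_simps)
  also have "e^2 + q * a * c = b^2 * d^2 / (a * c)"
    using nz by (simp add: divide_simps) (use t10_three_term_3[OF q, unfolded defs] in algebra)
  also have "b / (c^2 * d) * (b^2 * d^2 / (a * c)) = b^3 * d / (a * c^3)"
    using nz by (simp add: divide_simps eval_nat_numeral)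
  finally show ?C unfolding defs .
qed

section \<open>The dissections\<close>

text \<open>The right-hand side A as a function of \<open>q\<close>, kept in the exact form of the
  theorem so that unfolding suffices at the end. \<open>dissection2\<close> is B.\<close>

definition dissection1 :: "complex \<Rightarrow> complex" where
  "dissection1 q =
      qpochs_inf [- (q^5), - (q^10), - (q^10), - (q^10), - (q^15), - (q^15), - (q^15), - (q^20)] (q^25)
        / qpochs_inf [q^5, q^10, q^10, q^10, q^15, q^15, q^15, q^20] (q^25)
    - 2 * q * qpochs_inf [- (q^5), - (q^10), - (q^10), - (q^15), - (q^15), - (q^20), - (q^25), - (q^25)] (q^25)
        / qpochs_inf [q^5, q^5, q^5, q^10, q^15, q^20, q^20, q^20] (q^25)
    + 4 * q^2 * qpochs_inf [- (q^5), - (q^10), - (q^10), - (q^15), - (q^15), - (q^20), - (q^25), - (q^25)] (q^25)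
        / qpochs_inf [q^5, q^5, q^10, q^10, q^15, q^15, q^20, q^20] (q^25)
    - 4 * q^3 * qpochs_inf [- (q^10), - (q^10), - (q^15), - (q^15), - (q^25), - (q^25), - (q^25), - (q^25)] (q^25)
        / qpochs_inf [q^5, q^5, q^5, q^10, q^15, q^20, q^20, q^20] (q^25)
    + 2 * q^4 * qpochs_inf [- (q^5), - (q^5), - (q^10), - (q^15), - (q^20), - (q^20), - (q^25), - (q^25)] (q^25)
        / qpochs_inf [q^5, q^10, q^10, q^10, q^15, q^15, q^15, q^20] (q^25)"

definition dissection2 :: "complex \<Rightarrow> complex" where
  "dissection2 q =
      qpochs_inf [- (q^5), - (q^5), - (q^5), - (q^10), - (q^15), - (q^20), - (q^20), - (q^20)] (q^25)
        / qpochs_inf [q^5, q^5, q^5, q^10, q^15, q^20, q^20, q^20] (q^25)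
    + 2 * q * qpochs_inf [- (q^5), - (q^10), - (q^10), - (q^15), - (q^15), - (q^20), - (q^25), - (q^25)] (q^25)
        / qpochs_inf [q^5, q^5, q^5, q^10, q^15, q^20, q^20, q^20] (q^25)
    - 4 * q^7 * qpochs_inf [- (q^5), - (q^5), - (q^20), - (q^20), - (q^25), - (q^25), - (q^25), - (q^25)] (q^25)
        / qpochs_inf [q^5, q^10, q^10, q^10, q^15, q^15, q^15, q^20] (q^25)
    - 4 * q^3 * qpochs_inf [- (q^5), - (q^5), - (q^10), - (q^15), - (q^20), - (q^20), - (q^25), - (q^25)] (q^25)
        / qpochs_inf [q^5, q^5, q^10, q^10, q^15, q^15, q^20, q^20] (q^25)
    - 2 * q^4 * qpochs_inf [- (q^5), - (q^5), - (q^10), - (q^15), - (q^20), - (q^20), - (q^25), - (q^25)] (q^25)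
        / qpochs_inf [q^5, q^10, q^10, q^10, q^15, q^15, q^15, q^20] (q^25)"

section \<open>Holomorphy and non-vanishing on the unit disc\<close>

lemma qpoch_inf_holomorphic_intros [holomorphic_intros]:
  assumes "0 < b"
  shows "(\<lambda>q. qpoch_inf (q ^ a) (q ^ b)) holomorphic_on ball 0 1"
    and "(\<lambda>q. qpoch_inf (- (q ^ a)) (q ^ b)) holomorphic_on ball 0 1"
    and "(\<lambda>q. qpoch_inf q (q ^ b)) holomorphic_on ball 0 1"
  using holomorphic_qpoch_inf[OF assms, of 1 a] holomorphic_qpoch_inf[OF assms, of "-1" a]
    holomorphic_qpoch_inf[OF assms, of 1 1] by simp_all

lemma qpoch_inf_power_nonzero:
  assumes "norm q < 1" "0 < a" "0 < b"
  shows "qpoch_inf (q ^ a) (q ^ b) \<noteq> 0"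
  using assms by (intro qpoch_inf_nonzero) (auto simp: norm_power power_less_one_iff)

lemma qpoch_inf_power_nonzero': "norm q < 1 \<Longrightarrow> 0 < b \<Longrightarrow> qpoch_inf q (q ^ b) \<noteq> 0"
  using qpoch_inf_power_nonzero[of q 1 b] by simp

lemma RR_nonzero: "norm q < 1 \<Longrightarrow> RR q \<noteq> 0"
  by (simp add: RR_def qpochs_inf_def qpoch_inf_power_nonzero qpoch_inf_power_nonzero')

lemma RR_holomorphic: "RR holomorphic_on ball 0 1"
  unfolding RR_def qpochs_inf_def
  by (auto intro!: holomorphic_intros simp: qpoch_inf_power_nonzero)

lemma dissection_holomorphic:
  "dissection1 holomorphic_on ball 0 1" "dissection2 holomorphic_on ball 0 1"
  unfolding dissection1_def[abs_def] dissection2_def[abs_def] qpochs_inf_def list.map prod_list.Cons prod_list.Nil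
  by (auto intro!: holomorphic_intros simp: qpoch_inf_power_nonzero)

lemma RR_quotient_holomorphic: "(\<lambda>q. (RR q)^2 / RR (q^2)) holomorphic_on ball 0 1"
proof -
  have n: "norm (q^2) < 1" if "norm q < 1" for q :: complex
    using that by (simp add: norm_power power_less_one_iff)
  have "(RR \<circ> (\<lambda>q. q^2)) holomorphic_on ball 0 1"
    by (rule holomorphic_on_compose_gen[OF _ RR_holomorphic]) (auto intro!: holomorphic_intros n)
  then show ?thesis
    unfolding o_def
    by (auto intro!: holomorphic_intros RR_holomorphic simp: RR_nonzero n)
qed

text \<open>Parameters \<open>Q^j\<close> and \<open>Q^(5-j)\<close> always occur equally often, so
  they pair into theta functions of base \<open>Q^5\<close>; the parameters \<open>- (q^25)\<close>
  occur in pairs too and give powers of \<open>m\<close>.\<close>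

lemma dissection_eq_theta5:
  assumes q: "q \<noteq> 0"
  defines "Q \<equiv> q^5"
  defines "T1 \<equiv> theta Q (Q^5)" and "T2 \<equiv> theta (Q^2) (Q^5)"
    and "S1 \<equiv> theta (- Q) (Q^5)" and "S2 \<equiv> theta (- (Q^2)) (Q^5)" and "m \<equiv> (qpoch_inf (- (Q^5)) (Q^5))^2"
  shows "dissection1 q = S1 * S2^3 / (T1 * T2^3) - 2 * q * (S1 * S2^2 * m / (T1^3 * T2))
      + 4 * q^2 * (S1 * S2^2 * m / (T1^2 * T2^2)) - 4 * q^3 * (S2^2 * m^2 / (T1^3 * T2))
      + 2 * q^4 * (S1^2 * S2 * m / (T1 * T2^3))" (is ?r1)
    and "dissection2 q = S1^3 * S2 / (T1^3 * T2) + 2 * q * (S1 * S2^2 * m / (T1^3 * T2))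
      - 4 * q^7 * (S1^2 * m^2 / (T1 * T2^3)) - 4 * q^3 * (S1^2 * S2 * m / (T1^2 * T2^2))
      - 2 * q^4 * (S1^2 * S2 * m / (T1 * T2^3))" (is ?r2)
proof -
  have p: "q^25 = Q^5" "q^10 = Q^2" "q^15 = Q^3" "q^20 = Q^4" "q^5 = Q"
    by (simp_all add: Q_def flip: power_mult)
  have Q: "Q \<noteq> 0" using q by (simp add: Q_def)
  have d: "Q^5 / Q = Q^4" "Q^5 / Q^2 = Q^3"
    using Q by (simp_all add: field_simps eval_nat_numeral)
  define A1 A2 A3 A4 B1 B2 B3 B4 M where
    "A1 = qpoch_inf Q (Q^5)" and "A2 = qpoch_inf (Q^2) (Q^5)" and "A3 = qpoch_inf (Q^3) (Q^5)"
    and "A4 = qpoch_inf (Q^4) (Q^5)" and "B1 = qpoch_inf (- Q) (Q^5)" and "B2 = qpoch_inf (- (Q^2)) (Q^5)"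
    and "B3 = qpoch_inf (- (Q^3)) (Q^5)" and "B4 = qpoch_inf (- (Q^4)) (Q^5)" and "M = qpoch_inf (- (Q^5)) (Q^5)"
  note f = this[symmetric]
  have T: "T1 = A1 * A4" "T2 = A2 * A3" "S1 = B1 * B4" "S2 = B2 * B3" "m = M * M"
    unfolding T1_def T2_def S1_def S2_def m_def theta_def divide_minus_right d f
    by (simp_all add: power2_eq_square)
  show ?r1 ?r2
    unfolding dissection1_def dissection2_def p qpochs_inf_def list.map prod_list.Cons prod_list.Nil f T
    by (simp_all only: power2_eq_square power3_eq_cube mult_1_right mult_1_left times_divide_eq_right mult_ac)
qed

text \<open>By the values of \<open>1 - K\<close> and \<open>1 + K\<close> the quotient
  \<open>F\<close> is (1 - K) / (1 + K), so 1/F - F is 4 K / (1 - K^2), a monomial in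
  \<open>t10\<close>.\<close>

lemma level_ten_quotient:
  assumes q: "norm q < 1" "q \<noteq> 0"
  defines "F \<equiv> (RR q)^2 / RR (q^2)"
  shows "(1 / F - F) * qpoch_inf (- q) q = 4 * q * (qpoch_inf (- (q^5)) (q^5))^5"
proof -
  define a b c d e where "a = t10 q 1" and "b = t10 q 2" and "c = t10 q 3" and "d = t10 q 4" and "e = t10 q 5"
  note defs = this[symmetric]
  define K where "K = q * RR q * (RR (q^2))^2"
  define M where "M = qpoch_inf (- (q^5)) (q^5)"
  have nz: "a \<noteq> 0" "b \<noteq> 0" "c \<noteq> 0" "d \<noteq> 0" "e \<noteq> 0"
    using t10_nonzero[OF q] by (auto simp: a_def b_def c_def d_def e_def)
  have K: "K = q * a * b / (c * d)" "1 - K = e * a * d / (b * c^2)" "1 + K = e * b^2 / (a * d^2)"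
    using level_ten_relations(1,2)[OF q] nz unfolding K_def RR_t10[OF q] defs
    by (simp_all add: field_simps power2_eq_square)
  have F: "F = (1 - K) / (1 + K)"
    unfolding F_def RR_t10[OF q] K(2,3) defs using nz by (simp add: divide_simps eval_nat_numeral)
  have K0: "1 - K \<noteq> 0" "1 + K \<noteq> 0"
    unfolding K(2,3) using nz by simp_all
  have "1 / F - F = 4 * K / ((1 - K) * (1 + K))"
    unfolding F using K0 by (simp add: divide_simps) (simp add: algebra_simps)
  also have "\<dots> = 4 * q * a * c / e^2"
    unfolding K(2,3) using nz by (simp add: K(1) divide_simps power2_eq_square)
  finally have "1 / F - F = 4 * q * a * c / e^2" .
  moreover have "qpoch_inf (- q) q = M / (a * c)" and M2: "M^2 = 1 / e"
    using qpoch_inf_minus_self_t10(1,3)[OF q, folded M_def, unfolded defs] by simp_all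
  moreover have "M^5 = M / e^2"
  proof -
    have "M^5 = M * (M^2)^2" by (simp add: eval_nat_numeral)
    then show ?thesis unfolding M2 by (simp add: power_divide)
  qed
  ultimately show ?thesis
    using nz by (simp add: M_def[symmetric])
qed

text \<open>The dissection is used at \<open>q\<close> and at \<open>q^2\<close>, and (q;
  q)_infinity times (-q; q)_infinity equals (q^2; q^2)_infinity. The second claim holds because that
  last product does not vanish.\<close>

lemma RR_dissection_product:
  fixes q :: complex
  assumes q: "norm q < 1" "q \<noteq> 0"
  defines "u \<equiv> RR (q^5)" and "v \<equiv> RR (q^10)"
  shows "qpoch_inf (- q) q * (1 / u - q - q^2 * u)
       = qpoch_inf (- (q^25)) (q^25) * (1 / v - q^2 - q^4 * v)"
    and "1 / v - q^2 - q^4 * v \<noteq> 0"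
proof -
  have dis: "qpoch_inf x x = qpoch_inf (x^25) (x^25) * (1 / RR (x^5) - x - x^2 * RR (x^5))"
    if x: "norm x < 1" "x \<noteq> 0" for x :: complex
  proof -
    define Q where "Q = x^5"
    define P where "P = x^25"
    have P: "norm P < 1" "P \<noteq> 0" and Q: "Q \<noteq> 0" "norm Q < 1"
      using x by (auto simp: P_def Q_def norm_power power_less_one_iff)
    have PQ: "P = Q^5" and e: "(Q^2)^2 = Q^4" "P / Q = Q^4" "P / Q^4 = Q" "P / Q^2 = Q^3"
      using Q by (simp_all add: P_def Q_def flip: power_mult power_diff)
    have nz: "theta Q P \<noteq> 0" "theta (Q^2) P \<noteq> 0"
      using theta_nonzero[OF P(1), of Q] theta_nonzero[OF P(1), of "Q^2"] Q
      by (simp_all add: e norm_power power_less_one_iff)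
    have u: "RR Q = theta Q P / theta (Q^2) P"
      unfolding PQ by (rule RR_eq_theta[OF Q(1)])
    \<comment> \<open>At \<open>- Q\<close> the quintuple product is a theta quotient, here the
      reciprocal of \<open>RR Q\<close>; at \<open>- (Q^2)\<close> it becomes \<open>RR Q\<close>
      itself.\<close>
    have "theta (- Q) P * theta (P * Q^2) (P^2) = 1 / RR Q"
      using theta_quintuple_quotient[OF P, of "- Q"] Q nz unfolding u by (simp add: field_simps)
    moreover have "theta (Q^4) P = theta Q P"
      using theta_reflect[OF P(2) Q(1)] by (simp add: e)
    then have "theta (- (Q^2)) P * theta (P * Q^4) (P^2) = RR Q"
      using theta_quintuple_quotient[OF P, of "- (Q^2)"] Q nz unfolding u by (simp add: field_simps e)
    ultimately show ?thesis
      using euler_dissection[OF x] unfolding Q_def[symmetric] P_def[symmetric] by simp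
  qed
  have q2: "norm (q^2) < 1" "q^2 \<noteq> 0" and P: "norm (q^25) < 1"
    using q by (auto simp: norm_power power_less_one_iff)
  have e: "(q^2)^5 = q^10" "(q^2)^25 = (q^25)^2" "(q^2)^2 = q^4"
    by (simp_all flip: power_mult)
  have E2: "qpoch_inf (q^2) (q^2) = qpoch_inf ((q^25)^2) ((q^25)^2) * (1 / v - q^2 - q^4 * v)"
    using dis[OF q2] unfolding e v_def .
  then show "1 / v - q^2 - q^4 * v \<noteq> 0"
    using qpoch_inf_nonzero[OF q2(1) q2(1)] by auto
  have E0: "qpoch_inf (q^25) (q^25) \<noteq> 0"
    by (rule qpoch_inf_nonzero[OF P P])
  have "qpoch_inf (q^25) (q^25) * (qpoch_inf (- q) q * (1 / u - q - q^2 * u)) = qpoch_inf q q * qpoch_inf (- q) q"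
    using dis[OF q] by (simp add: u_def)
  also have "\<dots> = qpoch_inf (q^2) (q^2)"
    by (rule qpoch_inf_mult_minus[OF q(1)])
  also have "\<dots> = qpoch_inf (q^25) (q^25) * (qpoch_inf (- (q^25)) (q^25) * (1 / v - q^2 - q^4 * v))"
    unfolding E2 qpoch_inf_mult_minus[OF P, symmetric] by simp
  finally show "qpoch_inf (- q) q * (1 / u - q - q^2 * u)
       = qpoch_inf (- (q^25)) (q^25) * (1 / v - q^2 - q^4 * v)"
    using E0 by simp
qed

text \<open>The cofactors come from polynomial division by \<open>x\<^sup>2 (1 + K) - y (1 - K)\<close>.\<close>

lemma modular_relation_consequences:
  fixes x y K :: complex
  assumes K: "K = x * y^2" and R: "x^2 * (1 + K) = y * (1 - K)"
  defines "P1 \<equiv> (1 - K)^2 - 2 * x * (1 + K) + 4 * x^2 * (1 + K) - 4 * x * y + 2 * y^2 * (1 - K)"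
    and "P2 \<equiv> (1 + K)^2 + 2 * x * (1 + K) - 4 * y * K - 4 * x * y * (1 + K) - 2 * y^2 * (1 - K)"
  shows "P1 * P2 = (1 - 4 * K - K^2)^2"
    and "(P2 - P1) * x * (1 - y - y^2) = 4 * y * (1 - x - x^2) * (1 + K - K^2)"
proof -
  have "P1 * P2 - (1 - 4 * K - K^2)^2
     = (4 * y^3 + 8 * x - 16 * x * y + 4 * x * y^2 - 8 * x * y^3 + 8 * x * y^4 - 4 * x * y^5 + 8 * x^2 * y^2 - 16 * x^2 * y^3 + 4 * x^2 * y^4) * (x^2 * (1 + K) - y * (1 - K))"
    unfolding P1_def P2_def K by algebra
  then show "P1 * P2 = (1 - 4 * K - K^2)^2"
    using R by simp
  have "(P2 - P1) * x * (1 - y - y^2) - 4 * y * (1 - x - x^2) * (1 + K - K^2)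
     = (4 - 4 * x + 4 * x * y + 4 * x * y^2 - 4 * x * y^3) * (x^2 * (1 + K) - y * (1 - K))"
    unfolding P1_def P2_def K by algebra
  then show "(P2 - P1) * x * (1 - y - y^2) = 4 * y * (1 - x - x^2) * (1 + K - K^2)"
    using R by simp
qed

text \<open>With A B = 1, the relation B - A = 1/F - F is a quadratic equation for F with roots A
  and -B.\<close>

lemma quotient_dichotomy:
  assumes q: "norm q < 1" "q \<noteq> 0"
  shows "dissection1 q * dissection2 q = 1"
    and "((RR q)^2 / RR (q^2) - dissection1 q) * ((RR q)^2 / RR (q^2) + dissection2 q) = 0"
proof -
  define Q where "Q = q^5"
  define a b c d e where "a = t10 Q 1" and "b = t10 Q 2" and "c = t10 Q 3" and "d = t10 Q 4" and "e = t10 Q 5"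
  note defs = this[symmetric]
  define M where "M = qpoch_inf (- (Q^5)) (Q^5)"
  define x y where "x = q * (a * d / (b * c))" and "y = q^2 * (b / d)"
  define K where "K = x * y^2"
  define D where "D = 1 - 4 * K - K^2"
  define F where "F = (RR q)^2 / RR (q^2)"
  have Q: "norm Q < 1" "Q \<noteq> 0"
    using q by (auto simp: Q_def norm_power power_less_one_iff)
  have nz: "a \<noteq> 0" "b \<noteq> 0" "c \<noteq> 0" "d \<noteq> 0" "e \<noteq> 0"
    using t10_nonzero[OF Q] by (auto simp: a_def b_def c_def d_def e_def)
  have uv: "RR (q^5) = a * d / (b * c)" "RR (q^10) = b / d"
  proof -
    have "q^5 = Q" "q^10 = Q^2" by (simp_all add: Q_def flip: power_mult)
    then show "RR (q^5) = a * d / (b * c)" "RR (q^10) = b / d"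
      using RR_t10[OF Q, unfolded defs] by (simp_all only:)
  qed
  have "Q * RR Q * (RR (Q^2))^2 = K"
    unfolding RR_t10[OF Q] defs K_def x_def y_def by (simp add: Q_def field_simps eval_nat_numeral)
  note rel = level_ten_relations[OF Q, unfolded this defs]
  have Dm: "D = e^2 * a^4 * b^3 * c^2 * d"
    unfolding D_def rel(3) ..
  have D0: "D \<noteq> 0" unfolding Dm using nz by simp
  have q5: "q^7 = q^2 * Q" by (simp add: Q_def eval_nat_numeral)
  have Kq: "K = Q * a * b / (c * d)"
    unfolding K_def x_def y_def using nz by (simp add: Q_def field_simps eval_nat_numeral)
  have M2: "M^2 = 1 / e"
    using qpoch_inf_minus_self_t10(1)[OF Q, folded M_def, unfolded defs] .
  \<comment> \<open>This restates that (1 - K) / (1 + K) is the quotient \<open>F\<close> taken at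
    \<open>Q\<close>, since the powers of \<open>q\<close> in \<open>x^2\<close> and
    \<open>y\<close> agree.\<close>
  have R: "x^2 * (1 + K) = y * (1 - K)"
    unfolding rel(1,2) x_def y_def using nz by (simp add: field_simps eval_nat_numeral)
  define P1 where "P1 = (1 - K)^2 - 2 * x * (1 + K) + 4 * x^2 * (1 + K) - 4 * x * y + 2 * y^2 * (1 - K)"
  define P2 where "P2 = (1 + K)^2 + 2 * x * (1 + K) - 4 * y * K - 4 * x * y * (1 + K) - 2 * y^2 * (1 - K)"
  note mono = field_simps eval_nat_numeral
  define S1 S2 T1 T2 m where "S1 = b / (a * d)" and "S2 = d / (b * c)" and "T1 = a * d" and "T2 = b * c"
    and "m = 1 / e"
  \<comment> \<open>Both sides are monomials in \<open>t10 Q\<close>, \<open>q\<close> and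
    \<open>Q\<close>; each term of the dissections becomes a polynomial in \<open>x\<close> and
    \<open>y\<close> over the common denominator \<open>D\<close>.\<close>
  have Y: "S1 * S2^3 / (T1 * T2^3) = (1 - K)^2 / D"
    "q * (S1 * S2^2 * m / (T1^3 * T2)) = x * (1 + K) / D"
    "q^2 * (S1 * S2^2 * m / (T1^2 * T2^2)) = x^2 * (1 + K) / D"
    "q^3 * (S2^2 * m^2 / (T1^3 * T2)) = x * y / D"
    "q^4 * (S1^2 * S2 * m / (T1 * T2^3)) = y^2 * (1 - K) / D"
    "S1^3 * S2 / (T1^3 * T2) = (1 + K)^2 / D"
    "q^7 * (S1^2 * m^2 / (T1 * T2^3)) = y * K / D"
    "q^3 * (S1^2 * S2 * m / (T1^2 * T2^2)) = x * y * (1 + K) / D"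
    unfolding rel(1,2)
    unfolding Dm x_def y_def Kq S1_def S2_def T1_def T2_def m_def q5
    using nz by (simp_all add: divide_simps) (simp_all add: eval_nat_numeral)
  have r1: "dissection1 q = S1 * S2^3 / (T1 * T2^3) - 2 * (q * (S1 * S2^2 * m / (T1^3 * T2)))
      + 4 * (q^2 * (S1 * S2^2 * m / (T1^2 * T2^2))) - 4 * (q^3 * (S2^2 * m^2 / (T1^3 * T2)))
      + 2 * (q^4 * (S1^2 * S2 * m / (T1 * T2^3)))"
    unfolding dissection_eq_theta5(1)[OF q(2), folded Q_def] theta5_eq_t10[OF Q] M_def[symmetric] M2 defs
      S1_def S2_def T1_def T2_def m_def mult.assoc ..
  have P1: "dissection1 q * D = P1"
    unfolding r1 Y P1_def using D0 by (simp add: field_simps)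
  have r2: "dissection2 q = S1^3 * S2 / (T1^3 * T2) + 2 * (q * (S1 * S2^2 * m / (T1^3 * T2)))
      - 4 * (q^7 * (S1^2 * m^2 / (T1 * T2^3))) - 4 * (q^3 * (S1^2 * S2 * m / (T1^2 * T2^2)))
      - 2 * (q^4 * (S1^2 * S2 * m / (T1 * T2^3)))"
    unfolding dissection_eq_theta5(2)[OF q(2), folded Q_def] theta5_eq_t10[OF Q] M_def[symmetric] M2 defs
      S1_def S2_def T1_def T2_def m_def mult.assoc ..
  have P2: "dissection2 q * D = P2"
    unfolding r2 Y P2_def using D0 by (simp add: field_simps)
  have "(dissection1 q * dissection2 q) * D^2 = P1 * P2"
    unfolding P1[symmetric] P2[symmetric] by (simp add: power2_eq_square)
  also have "\<dots> = D^2"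
    unfolding P1_def P2_def D_def by (rule modular_relation_consequences(1)[OF K_def R])
  finally show one: "dissection1 q * dissection2 q = 1"
    using D0 by simp
  have F0: "F \<noteq> 0"
    using RR_nonzero[of q] RR_nonzero[of "q^2"] q by (simp add: F_def norm_power power_less_one_iff)
  have X: "(1 / F - F) * qpoch_inf (- q) q = 4 * q * (qpoch_inf (- Q) Q)^5"
    unfolding F_def Q_def by (rule level_ten_quotient[OF q])
  have MQ: "(qpoch_inf (- Q) Q)^5 * D = M * (1 + K - K^2)"
  proof -
    have "(qpoch_inf (- Q) Q)^5 = M * (M^2)^2 / (a * c)^5"
      unfolding qpoch_inf_minus_self_t10(3)[OF Q] M_def[symmetric] defs by (simp add: power_divide eval_nat_numeral)
    then show ?thesis
      unfolding M2 rel(4) Dm using nz by (simp add: mono)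
  qed
  have "q * (qpoch_inf (- q) q * (y * (1 - x - x^2))) = q * (q * M * (x * (1 - y - y^2)))"
    and y0: "1 - y - y^2 \<noteq> 0"
  proof -
    have PQ: "q^25 = Q^5" by (simp add: Q_def flip: power_mult)
    \<comment> \<open>The scaling by \<open>x\<close> and \<open>y\<close> makes the two trinomials
      free of \<open>q\<close> up to monomial factors.\<close>
    have u: "1 / (a * d / (b * c)) - q - q^2 * (a * d / (b * c)) = q * (1 - x - x^2) / x"
      unfolding x_def using nz q by (simp add: divide_simps) (simp add: algebra_simps power2_eq_square)
    have v: "1 / (b / d) - q^2 - q^4 * (b / d) = q^2 * (1 - y - y^2) / y"
      unfolding y_def using nz q by (simp add: divide_simps) (simp add: algebra_simps eval_nat_numeral)
    have xy: "x \<noteq> 0" "y \<noteq> 0" using nz q by (simp_all add: x_def y_def)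
    note dp = RR_dissection_product[OF q, unfolded uv u v PQ, folded M_def]
    show "1 - y - y^2 \<noteq> 0" using dp(2) by auto
    show "q * (qpoch_inf (- q) q * (y * (1 - x - x^2))) = q * (q * M * (x * (1 - y - y^2)))"
      using dp(1) xy by (simp add: field_simps power2_eq_square)
  qed
  then have dp: "qpoch_inf (- q) q * (y * (1 - x - x^2)) = q * M * (x * (1 - y - y^2))"
    using q(2) by simp
  define N where "N = qpoch_inf (- q) q"
  have N0: "N \<noteq> 0"
    unfolding N_def using q by (intro qpoch_inf_nonzero) auto
  have x0: "x \<noteq> 0" using nz q by (simp add: x_def)
  \<comment> \<open>Multiplying by this nonzero factor lets the dissection formula and the
    polynomial identity be applied without dividing by \<open>1 - x - x^2\<close>.\<close>
  have "N * (x * (1 - y - y^2)) * ((1 / F - F) * D)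
      = ((1 / F - F) * N) * D * (x * (1 - y - y^2))"
    by (simp only: mult_ac)
  also have "\<dots> = 4 * q * ((qpoch_inf (- Q) Q)^5 * D) * (x * (1 - y - y^2))"
    unfolding N_def X by (simp only: mult_ac)
  also have "\<dots> = 4 * (1 + K - K^2) * (q * M * (x * (1 - y - y^2)))"
    unfolding MQ by (simp only: mult_ac)
  also have "\<dots> = N * (4 * y * (1 - x - x^2) * (1 + K - K^2))"
    unfolding dp[symmetric] N_def by (simp only: mult_ac)
  also have "\<dots> = N * ((P2 - P1) * x * (1 - y - y^2))"
    unfolding P1_def P2_def by (subst modular_relation_consequences(2)[OF K_def R]) simp
  also have "\<dots> = N * (x * (1 - y - y^2)) * ((dissection2 q - dissection1 q) * D)"
    unfolding P1[symmetric] P2[symmetric] by (simp add: algebra_simps)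
  finally have "1 / F - F = dissection2 q - dissection1 q"
    using N0 x0 y0 D0 by simp
  then have "F * (dissection2 q - dissection1 q) = 1 - F^2"
    using F0 by (simp add: field_simps power2_eq_square)
  then have "(F - dissection1 q) * (F + dissection2 q) = 0"
    using one by (simp add: algebra_simps power2_eq_square)
  then show "((RR q)^2 / RR (q^2) - dissection1 q) * ((RR q)^2 / RR (q^2) + dissection2 q) = 0"
    unfolding F_def .
qed

text \<open>Near the origin the second factor of the dichotomy is not zero, so the first one is; the
  identity theorem extends this to the disc. The second identity is the reciprocal of the first
  because A B = 1.\<close>

lemma RR_quotient_eq_dissections:
  fixes q :: complex
  assumes "norm q < 1"
  shows "(RR q)^2 / RR (q^2) = dissection1 q \<and> RR (q^2) / (RR q)^2 = dissection2 q"
proof -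
  let ?F = "\<lambda>q. (RR q)^2 / RR (q^2)"
  have RR0: "RR 0 = 1"
    by (simp add: RR_def qpochs_inf_def)
  have at0: "?F 0 = 1" "dissection1 0 = 1" "dissection2 0 = 1"
    by (simp_all add: RR_def dissection1_def dissection2_def qpochs_inf_def)
  define U where "U = {z \<in> ball 0 1. ?F z + dissection2 z \<in> - {0}}"
  have "continuous_on (ball 0 1) (\<lambda>z. ?F z + dissection2 z)"
    by (intro holomorphic_on_imp_continuous_on holomorphic_intros RR_quotient_holomorphic dissection_holomorphic)
  then have "open U"
    unfolding U_def by (intro continuous_open_preimage[unfolded vimage_def Int_def mem_Collect_eq]) auto
  have "0 \<in> U" using at0 by (simp add: U_def RR0)
  with \<open>open U\<close> have lim: "0 islimpt U"
    by (intro interior_limit_point) (simp add: interior_open)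
  \<comment> \<open>The dichotomy assumes a nonzero argument, so the origin is checked by
    evaluation.\<close>
  have zero: "?F z - dissection1 z = 0" if "z \<in> U" for z
    using that quotient_dichotomy(2)[of z] at0 by (cases "z = 0") (auto simp: U_def)
  have "?F q - dissection1 q = 0"
    by (rule analytic_continuation[where f = "\<lambda>z. ?F z - dissection1 z" and S = "ball 0 1" and U = U, OF _ _ _ _ _ lim zero])
       (use assms in \<open>auto intro!: holomorphic_intros RR_quotient_holomorphic dissection_holomorphic simp: U_def\<close>)
  moreover have "dissection1 q * dissection2 q = 1"
    using quotient_dichotomy(1)[OF assms] at0 by (cases "q = 0") auto
  moreover have "RR (q^2) / (RR q)^2 = 1 / ?F q" by simp
  ultimately show ?thesis
    by (auto simp: divide_eq_eq mult.commute)
qed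

theorem theorem1p2:
  fixes q :: complex
  assumes "norm q < 1"
  shows "((RR q)^2 / RR (q^2) =
      qpochs_inf [- (q^5), - (q^10), - (q^10), - (q^10), - (q^15), - (q^15), - (q^15), - (q^20)] (q^25)
        / qpochs_inf [q^5, q^10, q^10, q^10, q^15, q^15, q^15, q^20] (q^25)
    - 2 * q * qpochs_inf [- (q^5), - (q^10), - (q^10), - (q^15), - (q^15), - (q^20), - (q^25), - (q^25)] (q^25)
        / qpochs_inf [q^5, q^5, q^5, q^10, q^15, q^20, q^20, q^20] (q^25)
    + 4 * q^2 * qpochs_inf [- (q^5), - (q^10), - (q^10), - (q^15), - (q^15), - (q^20), - (q^25), - (q^25)] (q^25)
        / qpochs_inf [q^5, q^5, q^10, q^10, q^15, q^15, q^20, q^20] (q^25)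
    - 4 * q^3 * qpochs_inf [- (q^10), - (q^10), - (q^15), - (q^15), - (q^25), - (q^25), - (q^25), - (q^25)] (q^25)
        / qpochs_inf [q^5, q^5, q^5, q^10, q^15, q^20, q^20, q^20] (q^25)
    + 2 * q^4 * qpochs_inf [- (q^5), - (q^5), - (q^10), - (q^15), - (q^20), - (q^20), - (q^25), - (q^25)] (q^25)
        / qpochs_inf [q^5, q^10, q^10, q^10, q^15, q^15, q^15, q^20] (q^25))
  \<and> (RR (q^2) / (RR q)^2 =
      qpochs_inf [- (q^5), - (q^5), - (q^5), - (q^10), - (q^15), - (q^20), - (q^20), - (q^20)] (q^25)
        / qpochs_inf [q^5, q^5, q^5, q^10, q^15, q^20, q^20, q^20] (q^25)
    + 2 * q * qpochs_inf [- (q^5), - (q^10), - (q^10), - (q^15), - (q^15), - (q^20), - (q^25), - (q^25)] (q^25)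
        / qpochs_inf [q^5, q^5, q^5, q^10, q^15, q^20, q^20, q^20] (q^25)
    - 4 * q^7 * qpochs_inf [- (q^5), - (q^5), - (q^20), - (q^20), - (q^25), - (q^25), - (q^25), - (q^25)] (q^25)
        / qpochs_inf [q^5, q^10, q^10, q^10, q^15, q^15, q^15, q^20] (q^25)
    - 4 * q^3 * qpochs_inf [- (q^5), - (q^5), - (q^10), - (q^15), - (q^20), - (q^20), - (q^25), - (q^25)] (q^25)
        / qpochs_inf [q^5, q^5, q^10, q^10, q^15, q^15, q^20, q^20] (q^25)
    - 2 * q^4 * qpochs_inf [- (q^5), - (q^5), - (q^10), - (q^15), - (q^20), - (q^20), - (q^25), - (q^25)] (q^25)
        / qpochs_inf [q^5, q^10, q^10, q^10, q^15, q^15, q^15, q^20] (q^25))"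
  using RR_quotient_eq_dissections[OF assms] unfolding dissection1_def dissection2_def .

end
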